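(* Let $(\Sigma,m)$ be a pointed oriented surface with boundary. The formal contact category splits into a product of two pieces $$\mathcal{K}o(\Sigma,m)\cong\mathcal{K}o_+(\Sigma,m)\times\mathcal{K}o_-(\Sigma,m),$$ where $\mathcal{K}o_+(\Sigma,m)$ (respectively $\mathcal{K}o_-(\Sigma,m)$) is supported on the dividing sets $\gamma$ for which the basepoint $z_1\in\partial_1\Sigma$ is contained in a positive (respectively negative) region.
   Context: $\mathcal{K}o_\pm(\Sigma,m)$ is the full dg subcategory of $\mathcal{K}o(\Sigma,m)$ of one-sided twisted complexes built out of dividing sets $\gamma$ whose region containing $z_1$ has sign $\pm$. The symbol $\cong$ denotes isomorphism in $\mathrm{Hqe}$, the localization of the category of dg categories at quasi-equivalences. Algebra. $k$ is a field of characteristic $2$; dg categories are ungraded: each $\mathrm{Hom}(x,y)$ is a $k$-vector space with a differential $d$, $d^2=0$, satisfying the Leibniz rule. $\mathrm{Ho}(\mathcal{C})$ has the objects of $\mathcal{C}$ and $\mathrm{Hom}_{\mathrm{Ho}(\mathcal{C})}=H(\mathrm{Hom}_{\mathcal{C}},d)$. The pretriangulated hull $\mathcal{C}^{\mathrm{pretr}}$ has as objects one-sided twisted complexes $(\bigoplus_{i=1}^n x_i,p)$, $p=(p_{ij}:x_i\to x_j)$ with $p_{ij}=0$ for $j\le i$ and $dp+p^2=0$; maps are matrices $f$ with differential $f\mapsto (df_{ij})+p'f+fp$. Surfaces. A pointed oriented surface $\Sigma$ is a compact connected oriented surface with ordered boundary components $\partial_i\Sigma$, each with a basepoint $z_i$.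 A finite set of points $m\subset\partial\Sigma\setminus\{z_i\}$ is fixed; one writes $(\Sigma,m)$. A dividing set is a non-empty properly embedded multicurve $\gamma$ (closed curves and arcs; $\gamma\cap\partial\Sigma=m$) with disjoint subsurfaces $R_+,R_-$ (positive/negative regions, part of the data) such that $\Sigma\setminus\gamma=R_+\cup R_-$ and $\gamma=\partial R_\pm\setminus\partial\Sigma$. If $\partial\Sigma\neq\emptyset$, $|m|$ is even and $\geq2$. Isotopies fix basepoints and $m$. Bypass moves. An equator on $\gamma$ is an embedded arc $\ell$ in $\Sigma$ meeting $\gamma$ transversally in exactly three points $a<b<c$, with $a,c$ its endpoints. Identify a neighbourhood of $\ell$, preserving orientation, with $[-1,1]\times[-2,2]\subset\mathbb{R}^2$ so that $\ell=\{0\}\times[-1,1]$ and $\gamma=[-1,1]\times\{-1,0,1\}$; put $L_j=(-1,j)$, $R_j=(1,j)$. The bypass move $\theta:\gamma\to\gamma'$ replaces $\gamma$ inside the rectangle by three disjoint arcs joining $R_1$ to $R_0$, $L_0$ to $L_{-1}$, and $L_1$ to $R_{-1}$, with signs of regions determined by those outside. Two bypass moves are isotopic if the graphs $\gamma\cup\ell$ are isotopic. $\theta$ is capped if the segment $\{0\}\times[0,1]$ or $\{0\}\times[-1,0]$ of $\ell$ together with an arc of $\gamma$ bounds an embedded half-disk in $\Sigma$ with interior disjoint from $\gamma$ and meeting $\ell$ only in that segment; the cap is northwest (northeast) if it uses the upper segment and leaves it to the left (right), and southwest (southeast) if it uses the lower segment and leaves it to the left (right). Two distinct bypass moves on $\gamma$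 are disjoint if their equators can be made disjoint by isotopy with endpoints staying in $\gamma$; then each may be performed after the other. Bypass triangle: after performing $\theta_A:\gamma_A\to\gamma_B$ there is a unique equator up to isotopy inside the rectangle crossing the three new arcs once each, giving $\theta_B:\gamma_B\to\gamma_C$, and similarly $\theta_C:\gamma_C\to\gamma_A$. Contact categories. $\mathrm{Pre}\text{-}\mathcal{K}o(\Sigma,m)$ is the $k$-linear category (dg with $d=0$) with objects isotopy classes of dividing sets on $(\Sigma,m)$ and maps generated by isotopy classes of bypass moves, modulo: (1) bypass moves capped in the northwest or southeast equal $1$; (2) disjoint bypass moves commute. Let $D'$ be the dg category with objects $1,2,3$ freely generated by cycles $\theta_{12}:1\to2,\theta_{23}:2\to3,\theta_{31}:3\to1$, and $\bar D$ the dg category on the same objects generated by these cycles and maps $h_{21}:2\to1,h_{32}:3\to2,h_{13}:1\to3$ with $dh_{21}=\theta_{31}\theta_{23}$, $dh_{32}=\theta_{12}\theta_{31}$, $dh_{13}=\theta_{23}\theta_{12}$ and relations $\theta_{23}h_{32}+h_{13}\theta_{31}=1_3$, $\theta_{12}h_{21}+h_{32}\theta_{23}=1_2$, $\theta_{31}h_{13}+h_{21}\theta_{12}=1_1$. The bypass triangles define $\Xi:\coprod_\theta D'\to\mathrm{Pre}\text{-}\mathcal{K}o(\Sigma,m)$; $L_\Xi\mathrm{Pre}\text{-}\mathcal{K}o(\Sigma,m)$ is the homotopy pushout (for quasi-equivalences) of $\Xi$ along $\coprod_\theta D'\to\coprod_\theta\bar D$. The formal contact category is $\mathcal{K}o(\Sigma,m)=(L_\Xi\mathrm{Pre}\text{-}\mathcal{K}o(\Sigma,m))^{\mathrm{pretr}}$.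 *)

theory Defs
  imports "HOL-Complex_Analysis.Complex_Analysis" "HOL-Library.Poly_Mapping"
begin

section \<open>Ungraded dg categories\<close>

text \<open>
  All structure maps carry the objects as explicit arguments, so that morphism sets belonging to
  different pairs of objects need not be disjoint.  \<open>Comp C x y z g f\<close> is the composite
  \<open>g \<circ> f\<close> of \<open>f : x \<rightarrow> y\<close> and \<open>g : y \<rightarrow> z\<close>.  No signs appear in the Leibniz rule: the ground field
  is of characteristic 2 wherever these notions are used.
\<close>

record ('k, 'o, 'm) dgcat =
  Obj :: "'o set"
  Hom :: "'o \<Rightarrow> 'o \<Rightarrow> 'm set"
  Zero :: "'o \<Rightarrow> 'o \<Rightarrow> 'm"
  Add :: "'o \<Rightarrow> 'o \<Rightarrow> 'm \<Rightarrow> 'm \<Rightarrow> 'm"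
  Scale :: "'o \<Rightarrow> 'o \<Rightarrow> 'k \<Rightarrow> 'm \<Rightarrow> 'm"
  Diff :: "'o \<Rightarrow> 'o \<Rightarrow> 'm \<Rightarrow> 'm"
  Idn :: "'o \<Rightarrow> 'm"
  Comp :: "'o \<Rightarrow> 'o \<Rightarrow> 'o \<Rightarrow> 'm \<Rightarrow> 'm \<Rightarrow> 'm"

locale dg_category =
  fixes C :: "('k::field, 'o, 'm) dgcat"
  assumes zero_closed: "\<lbrakk>x \<in> Obj C; y \<in> Obj C\<rbrakk> \<Longrightarrow> Zero C x y \<in> Hom C x y"
    and add_closed: "\<lbrakk>x \<in> Obj C; y \<in> Obj C; f \<in> Hom C x y; g \<in> Hom C x y\<rbrakk>
      \<Longrightarrow> Add C x y f g \<in> Hom C x y"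
    and scale_closed: "\<lbrakk>x \<in> Obj C; y \<in> Obj C; f \<in> Hom C x y\<rbrakk> \<Longrightarrow> Scale C x y c f \<in> Hom C x y"
    and add_assoc: "\<lbrakk>x \<in> Obj C; y \<in> Obj C; f \<in> Hom C x y; g \<in> Hom C x y; h \<in> Hom C x y\<rbrakk>
      \<Longrightarrow> Add C x y (Add C x y f g) h = Add C x y f (Add C x y g h)"
    and add_commute: "\<lbrakk>x \<in> Obj C; y \<in> Obj C; f \<in> Hom C x y; g \<in> Hom C x y\<rbrakk>
      \<Longrightarrow> Add C x y f g = Add C x y g f"
    and add_zero: "\<lbrakk>x \<in> Obj C; y \<in> Obj C; f \<in> Hom C x y\<rbrakk> \<Longrightarrow> Add C x y f (Zero C x y) = f"
    and add_inverse: "\<lbrakk>x \<in> Obj C; y \<in> Obj C; f \<in> Hom C x y\<rbrakk>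
      \<Longrightarrow> \<exists>g\<in>Hom C x y. Add C x y f g = Zero C x y"
    and scale_one: "\<lbrakk>x \<in> Obj C; y \<in> Obj C; f \<in> Hom C x y\<rbrakk> \<Longrightarrow> Scale C x y 1 f = f"
    and scale_scale: "\<lbrakk>x \<in> Obj C; y \<in> Obj C; f \<in> Hom C x y\<rbrakk>
      \<Longrightarrow> Scale C x y a (Scale C x y b f) = Scale C x y (a * b) f"
    and scale_add: "\<lbrakk>x \<in> Obj C; y \<in> Obj C; f \<in> Hom C x y; g \<in> Hom C x y\<rbrakk>
      \<Longrightarrow> Scale C x y a (Add C x y f g) = Add C x y (Scale C x y a f) (Scale C x y a g)"
    and add_scale: "\<lbrakk>x \<in> Obj C; y \<in> Obj C; f \<in> Hom C x y\<rbrakk>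
      \<Longrightarrow> Scale C x y (a + b) f = Add C x y (Scale C x y a f) (Scale C x y b f)"
    and idn_closed: "x \<in> Obj C \<Longrightarrow> Idn C x \<in> Hom C x x"
    and comp_closed: "\<lbrakk>x \<in> Obj C; y \<in> Obj C; z \<in> Obj C; f \<in> Hom C x y; g \<in> Hom C y z\<rbrakk>
      \<Longrightarrow> Comp C x y z g f \<in> Hom C x z"
    and comp_idn: "\<lbrakk>x \<in> Obj C; y \<in> Obj C; f \<in> Hom C x y\<rbrakk> \<Longrightarrow> Comp C x x y f (Idn C x) = f"
    and idn_comp: "\<lbrakk>x \<in> Obj C; y \<in> Obj C; f \<in> Hom C x y\<rbrakk> \<Longrightarrow> Comp C x y y (Idn C y) f = f"
    and comp_assoc: "\<lbrakk>w \<in> Obj C; x \<in> Obj C; y \<in> Obj C; z \<in> Obj C;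
        f \<in> Hom C w x; g \<in> Hom C x y; h \<in> Hom C y z\<rbrakk>
      \<Longrightarrow> Comp C w x z (Comp C x y z h g) f = Comp C w y z h (Comp C w x y g f)"
    and comp_add_right: "\<lbrakk>x \<in> Obj C; y \<in> Obj C; z \<in> Obj C;
        f \<in> Hom C x y; f' \<in> Hom C x y; g \<in> Hom C y z\<rbrakk>
      \<Longrightarrow> Comp C x y z g (Add C x y f f') = Add C x z (Comp C x y z g f) (Comp C x y z g f')"
    and comp_add_left: "\<lbrakk>x \<in> Obj C; y \<in> Obj C; z \<in> Obj C;
        f \<in> Hom C x y; g \<in> Hom C y z; g' \<in> Hom C y z\<rbrakk>
      \<Longrightarrow> Comp C x y z (Add C y z g g') f = Add C x z (Comp C x y z g f) (Comp C x y z g' f)"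
    and comp_scale_right: "\<lbrakk>x \<in> Obj C; y \<in> Obj C; z \<in> Obj C; f \<in> Hom C x y; g \<in> Hom C y z\<rbrakk>
      \<Longrightarrow> Comp C x y z g (Scale C x y c f) = Scale C x z c (Comp C x y z g f)"
    and comp_scale_left: "\<lbrakk>x \<in> Obj C; y \<in> Obj C; z \<in> Obj C; f \<in> Hom C x y; g \<in> Hom C y z\<rbrakk>
      \<Longrightarrow> Comp C x y z (Scale C y z c g) f = Scale C x z c (Comp C x y z g f)"
    and diff_closed: "\<lbrakk>x \<in> Obj C; y \<in> Obj C; f \<in> Hom C x y\<rbrakk> \<Longrightarrow> Diff C x y f \<in> Hom C x y"
    and diff_add: "\<lbrakk>x \<in> Obj C; y \<in> Obj C; f \<in> Hom C x y; g \<in> Hom C x y\<rbrakk>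
      \<Longrightarrow> Diff C x y (Add C x y f g) = Add C x y (Diff C x y f) (Diff C x y g)"
    and diff_scale: "\<lbrakk>x \<in> Obj C; y \<in> Obj C; f \<in> Hom C x y\<rbrakk>
      \<Longrightarrow> Diff C x y (Scale C x y c f) = Scale C x y c (Diff C x y f)"
    and diff_diff: "\<lbrakk>x \<in> Obj C; y \<in> Obj C; f \<in> Hom C x y\<rbrakk>
      \<Longrightarrow> Diff C x y (Diff C x y f) = Zero C x y"
    and leibniz: "\<lbrakk>x \<in> Obj C; y \<in> Obj C; z \<in> Obj C; f \<in> Hom C x y; g \<in> Hom C y z\<rbrakk>
      \<Longrightarrow> Diff C x z (Comp C x y z g f) =
        Add C x z (Comp C x y z (Diff C y z g) f) (Comp C x y z g (Diff C x y f))"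

record ('o1, 'm1, 'o2, 'm2) dgfun =
  fob :: "'o1 \<Rightarrow> 'o2"
  fmo :: "'o1 \<Rightarrow> 'o1 \<Rightarrow> 'm1 \<Rightarrow> 'm2"

locale dg_functor = A: dg_category A + B: dg_category B
  for A :: "('k::field, 'o1, 'm1) dgcat" and B :: "('k, 'o2, 'm2) dgcat" +
  fixes F :: "('o1, 'm1, 'o2, 'm2) dgfun"
  assumes fob_closed: "x \<in> Obj A \<Longrightarrow> fob F x \<in> Obj B"
    and fmo_closed: "\<lbrakk>x \<in> Obj A; y \<in> Obj A; f \<in> Hom A x y\<rbrakk>
      \<Longrightarrow> fmo F x y f \<in> Hom B (fob F x) (fob F y)"
    and fmo_add: "\<lbrakk>x \<in> Obj A; y \<in> Obj A; f \<in> Hom A x y; g \<in> Hom A x y\<rbrakk>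
      \<Longrightarrow> fmo F x y (Add A x y f g) = Add B (fob F x) (fob F y) (fmo F x y f) (fmo F x y g)"
    and fmo_scale: "\<lbrakk>x \<in> Obj A; y \<in> Obj A; f \<in> Hom A x y\<rbrakk>
      \<Longrightarrow> fmo F x y (Scale A x y c f) = Scale B (fob F x) (fob F y) c (fmo F x y f)"
    and fmo_diff: "\<lbrakk>x \<in> Obj A; y \<in> Obj A; f \<in> Hom A x y\<rbrakk>
      \<Longrightarrow> fmo F x y (Diff A x y f) = Diff B (fob F x) (fob F y) (fmo F x y f)"
    and fmo_idn: "x \<in> Obj A \<Longrightarrow> fmo F x x (Idn A x) = Idn B (fob F x)"
    and fmo_comp: "\<lbrakk>x \<in> Obj A; y \<in> Obj A; z \<in> Obj A; f \<in> Hom A x y; g \<in> Hom A y z\<rbrakk>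
      \<Longrightarrow> fmo F x z (Comp A x y z g f) =
        Comp B (fob F x) (fob F y) (fob F z) (fmo F y z g) (fmo F x y f)"

definition dgfun_id :: "('o, 'm, 'o, 'm) dgfun" where
  "dgfun_id = \<lparr>fob = id, fmo = (\<lambda>x y. id)\<rparr>"

definition dgfun_comp ::
  "('o2, 'm2, 'o3, 'm3) dgfun \<Rightarrow> ('o1, 'm1, 'o2, 'm2) dgfun \<Rightarrow> ('o1, 'm1, 'o3, 'm3) dgfun" where
  "dgfun_comp G F = \<lparr>fob = (\<lambda>x. fob G (fob F x)),
     fmo = (\<lambda>x y f. fmo G (fob F x) (fob F y) (fmo F x y f))\<rparr>"

definition dgfun_eq_on ::
  "('k, 'o1, 'm1) dgcat \<Rightarrow> ('o1, 'm1, 'o2, 'm2) dgfun \<Rightarrow> ('o1, 'm1, 'o2, 'm2) dgfun \<Rightarrow> bool" where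
  "dgfun_eq_on A F G \<longleftrightarrow> (\<forall>x\<in>Obj A. fob F x = fob G x) \<and>
     (\<forall>x\<in>Obj A. \<forall>y\<in>Obj A. \<forall>f\<in>Hom A x y. fmo F x y f = fmo G x y f)"


subsection \<open>Homology and quasi-equivalences\<close>

definition cycles :: "('k, 'o, 'm) dgcat \<Rightarrow> 'o \<Rightarrow> 'o \<Rightarrow> 'm set" where
  "cycles C x y = {f \<in> Hom C x y. Diff C x y f = Zero C x y}"

definition homologous :: "('k, 'o, 'm) dgcat \<Rightarrow> 'o \<Rightarrow> 'o \<Rightarrow> ('m \<times> 'm) set" where
  "homologous C x y = {(f, g). f \<in> cycles C x y \<and> g \<in> cycles C x y \<and>
     (\<exists>h\<in>Hom C x y. f = Add C x y g (Diff C x y h))}"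

definition HoHom :: "('k, 'o, 'm) dgcat \<Rightarrow> 'o \<Rightarrow> 'o \<Rightarrow> 'm set set" where
  "HoHom C x y = cycles C x y // homologous C x y"

definition Ho_map ::
  "('k, 'o2, 'm2) dgcat \<Rightarrow> ('o1, 'm1, 'o2, 'm2) dgfun \<Rightarrow> 'o1 \<Rightarrow> 'o1 \<Rightarrow> 'm1 set \<Rightarrow> 'm2 set" where
  "Ho_map B F x y X = homologous B (fob F x) (fob F y) `` (fmo F x y ` X)"

definition Ho_isomorphic :: "('k, 'o, 'm) dgcat \<Rightarrow> 'o \<Rightarrow> 'o \<Rightarrow> bool" where
  "Ho_isomorphic C x y \<longleftrightarrow> (\<exists>f\<in>cycles C x y. \<exists>g\<in>cycles C y x.
     (Comp C x y x g f, Idn C x) \<in> homologous C x x \<and>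
     (Comp C y x y f g, Idn C y) \<in> homologous C y y)"

locale quasi_equivalence = dg_functor A B F
  for A :: "('k::field, 'o1, 'm1) dgcat" and B :: "('k, 'o2, 'm2) dgcat"
    and F :: "('o1, 'm1, 'o2, 'm2) dgfun" +
  assumes quasi_fully_faithful: "\<lbrakk>x \<in> Obj A; y \<in> Obj A\<rbrakk>
      \<Longrightarrow> bij_betw (Ho_map B F x y) (HoHom A x y) (HoHom B (fob F x) (fob F y))"
    and quasi_essentially_surjective: "b \<in> Obj B \<Longrightarrow> \<exists>a\<in>Obj A. Ho_isomorphic B (fob F a) b"


subsection \<open>The localization at quasi-equivalences\<close>

text \<open>
  Morphisms of the localization are represented by zigzags of dg functors and formal inverses
  \<open>Inv A w B : B \<rightarrow> A\<close> of quasi-equivalences \<open>w : A \<rightarrow> B\<close>, modulo the congruence generated by the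
  relations of the category of dg categories and by declaring \<open>Inv A w B\<close> inverse to \<open>w\<close>.  The
  dg categories involved are those carried by the fixed types \<open>'o\<close> and \<open>'m\<close>.
\<close>

datatype ('k, 'o, 'm) zigstep =
    Fwd "('k, 'o, 'm) dgcat" "('o, 'm, 'o, 'm) dgfun" "('k, 'o, 'm) dgcat"
  | Inv "('k, 'o, 'm) dgcat" "('o, 'm, 'o, 'm) dgfun" "('k, 'o, 'm) dgcat"

inductive zigzag ::
  "('k::field, 'o, 'm) dgcat \<Rightarrow> ('k, 'o, 'm) zigstep list \<Rightarrow> ('k, 'o, 'm) dgcat \<Rightarrow> bool" where
  zz_nil: "dg_category A \<Longrightarrow> zigzag A [] A"
| zz_fwd: "\<lbrakk>dg_functor A B F; zigzag B p C\<rbrakk> \<Longrightarrow> zigzag A (Fwd A F B # p) C"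
| zz_inv: "\<lbrakk>quasi_equivalence B A w; zigzag B p C\<rbrakk> \<Longrightarrow> zigzag A (Inv B w A # p) C"

inductive hqe_eq ::
  "('k::field, 'o, 'm) dgcat \<Rightarrow> ('k, 'o, 'm) dgcat
    \<Rightarrow> ('k, 'o, 'm) zigstep list \<Rightarrow> ('k, 'o, 'm) zigstep list \<Rightarrow> bool" where
  he_refl: "zigzag A p B \<Longrightarrow> hqe_eq A B p p"
| he_sym: "hqe_eq A B p q \<Longrightarrow> hqe_eq A B q p"
| he_trans: "\<lbrakk>hqe_eq A B p q; hqe_eq A B q r\<rbrakk> \<Longrightarrow> hqe_eq A B p r"
| he_cong: "\<lbrakk>hqe_eq A B p p'; hqe_eq B C q q'\<rbrakk> \<Longrightarrow> hqe_eq A C (p @ q) (p' @ q')"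
| he_id: "dg_category A \<Longrightarrow> hqe_eq A A [Fwd A dgfun_id A] []"
| he_comp: "\<lbrakk>dg_functor A B F; dg_functor B C G\<rbrakk>
    \<Longrightarrow> hqe_eq A C [Fwd A F B, Fwd B G C] [Fwd A (dgfun_comp G F) C]"
| he_ext: "\<lbrakk>dg_functor A B F; dg_functor A B G; dgfun_eq_on A F G\<rbrakk>
    \<Longrightarrow> hqe_eq A B [Fwd A F B] [Fwd A G B]"
| he_inv_right: "quasi_equivalence A B w \<Longrightarrow> hqe_eq A A [Fwd A w B, Inv A w B] []"
| he_inv_left: "quasi_equivalence A B w \<Longrightarrow> hqe_eq B B [Inv A w B, Fwd A w B] []"

definition hqe_isomorphic_in :: "('k::field, 'o, 'm) dgcat \<Rightarrow> ('k, 'o, 'm) dgcat \<Rightarrow> bool" where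
  "hqe_isomorphic_in A B \<longleftrightarrow> (\<exists>p q. zigzag A p B \<and> zigzag B q A \<and>
     hqe_eq A A (p @ q) [] \<and> hqe_eq B B (q @ p) [])"

text \<open>Transport of a dg category along injections of the carrier types.\<close>

definition dg_transport ::
  "('o \<Rightarrow> 'o2) \<Rightarrow> ('m \<Rightarrow> 'm2) \<Rightarrow> ('k, 'o, 'm) dgcat \<Rightarrow> ('k, 'o2, 'm2) dgcat" where
  "dg_transport a b C = (let a' = inv a; b' = inv b in
    \<lparr>Obj = a ` Obj C,
     Hom = (\<lambda>x y. b ` Hom C (a' x) (a' y)),
     Zero = (\<lambda>x y. b (Zero C (a' x) (a' y))),
     Add = (\<lambda>x y f g. b (Add C (a' x) (a' y) (b' f) (b' g))),
     Scale = (\<lambda>x y c f. b (Scale C (a' x) (a' y) c (b' f))),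
     Diff = (\<lambda>x y f. b (Diff C (a' x) (a' y) (b' f))),
     Idn = (\<lambda>x. b (Idn C (a' x))),
     Comp = (\<lambda>x y z g f. b (Comp C (a' x) (a' y) (a' z) (b' g) (b' f)))\<rparr>)"

text \<open>
  Dg categories with different carrier types are compared after embedding both into the sum types.
  An isomorphism there is also one for any larger choice of carrier types.
\<close>

definition hqe_isomorphic ::
  "('k::field, 'o1, 'm1) dgcat \<Rightarrow> ('k, 'o2, 'm2) dgcat \<Rightarrow> bool" (infix \<open>\<cong>\<^sub>H\<close> 50) where
  "A \<cong>\<^sub>H B \<longleftrightarrow> hqe_isomorphic_in
     (dg_transport (Inl :: 'o1 \<Rightarrow> 'o1 + 'o2) (Inl :: 'm1 \<Rightarrow> 'm1 + 'm2) A)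
     (dg_transport (Inr :: 'o2 \<Rightarrow> 'o1 + 'o2) (Inr :: 'm2 \<Rightarrow> 'm1 + 'm2) B)"


subsection \<open>Products, full subcategories, copowers and pushouts\<close>

definition dg_product ::
  "('k, 'o1, 'm1) dgcat \<Rightarrow> ('k, 'o2, 'm2) dgcat \<Rightarrow> ('k, 'o1 \<times> 'o2, 'm1 \<times> 'm2) dgcat"
  (infixr \<open>\<times>\<^sub>D\<close> 70) where
  "A \<times>\<^sub>D B =
    \<lparr>Obj = Obj A \<times> Obj B,
     Hom = (\<lambda>x y. Hom A (fst x) (fst y) \<times> Hom B (snd x) (snd y)),
     Zero = (\<lambda>x y. (Zero A (fst x) (fst y), Zero B (snd x) (snd y))),
     Add = (\<lambda>x y f g. (Add A (fst x) (fst y) (fst f) (fst g), Add B (snd x) (snd y) (snd f) (snd g))),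
     Scale = (\<lambda>x y c f. (Scale A (fst x) (fst y) c (fst f), Scale B (snd x) (snd y) c (snd f))),
     Diff = (\<lambda>x y f. (Diff A (fst x) (fst y) (fst f), Diff B (snd x) (snd y) (snd f))),
     Idn = (\<lambda>x. (Idn A (fst x), Idn B (snd x))),
     Comp = (\<lambda>x y z g f. (Comp A (fst x) (fst y) (fst z) (fst g) (fst f),
                           Comp B (snd x) (snd y) (snd z) (snd g) (snd f)))\<rparr>"

definition full_subcat :: "('k, 'o, 'm) dgcat \<Rightarrow> 'o set \<Rightarrow> ('k, 'o, 'm) dgcat" where
  "full_subcat C X = C\<lparr>Obj := Obj C \<inter> X\<rparr>"

text \<open>The coproduct of copies of \<open>C\<close> indexed by \<open>I\<close>; distinct copies are orthogonal.\<close>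

definition dg_copower :: "'i set \<Rightarrow> ('k, 'o, 'm) dgcat \<Rightarrow> ('k, 'i \<times> 'o, 'm) dgcat" where
  "dg_copower I C =
    \<lparr>Obj = I \<times> Obj C,
     Hom = (\<lambda>(i, x) (j, y). if i = j then Hom C x y else {Zero C x y}),
     Zero = (\<lambda>(i, x) (j, y). Zero C x y),
     Add = (\<lambda>(i, x) (j, y) f g. if i = j then Add C x y f g else Zero C x y),
     Scale = (\<lambda>(i, x) (j, y) c f. if i = j then Scale C x y c f else Zero C x y),
     Diff = (\<lambda>(i, x) (j, y) f. if i = j then Diff C x y f else Zero C x y),
     Idn = (\<lambda>(i, x). Idn C x),
     Comp = (\<lambda>(i, x) (j, y) (k, z) g f.
        if i = j \<and> j = k then Comp C x y z g f else Zero C x z)\<rparr>"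

definition copower_map ::
  "('o1, 'm1, 'o2, 'm2) dgfun \<Rightarrow> ('i \<times> 'o1, 'm1, 'i \<times> 'o2, 'm2) dgfun" where
  "copower_map F = \<lparr>fob = (\<lambda>(i, x). (i, fob F x)), fmo = (\<lambda>(i, x) (j, y) f. fmo F x y f)\<rparr>"

definition cotuple ::
  "('k, 'o2, 'm2) dgcat \<Rightarrow> ('i \<Rightarrow> ('o1, 'm1, 'o2, 'm2) dgfun)
    \<Rightarrow> ('i \<times> 'o1, 'm1, 'o2, 'm2) dgfun" where
  "cotuple A F = \<lparr>fob = (\<lambda>(i, x). fob (F i) x),
     fmo = (\<lambda>(i, x) (j, y) f.
       if i = j then fmo (F i) x y f else Zero A (fob (F i) x) (fob (F j) y))\<rparr>"

text \<open>
  \<open>L\<close> with \<open>J : A \<rightarrow> L\<close> and \<open>K : C \<rightarrow> L\<close> is a pushout of \<open>F : B \<rightarrow> A\<close> and \<open>G : B \<rightarrow> C\<close>.  The universal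
  property is tested on dg categories with the same carrier types as \<open>L\<close>; an unrestricted pushout
  realized on these types has this property in particular.
\<close>

definition is_dg_pushout ::
  "('k::field, 'o2, 'm2) dgcat \<Rightarrow> ('k, 'o1, 'm1) dgcat \<Rightarrow> ('k, 'o3, 'm3) dgcat
    \<Rightarrow> ('o2, 'm2, 'o1, 'm1) dgfun \<Rightarrow> ('o2, 'm2, 'o3, 'm3) dgfun
    \<Rightarrow> ('k, 'o, 'm) dgcat \<Rightarrow> ('o1, 'm1, 'o, 'm) dgfun \<Rightarrow> ('o3, 'm3, 'o, 'm) dgfun \<Rightarrow> bool" where
  "is_dg_pushout B A C F G L J K \<longleftrightarrow>
     dg_functor B A F \<and> dg_functor B C G \<and> dg_functor A L J \<and> dg_functor C L K \<and>
     dgfun_eq_on B (dgfun_comp J F) (dgfun_comp K G) \<and>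
     (\<forall>(T :: ('k, 'o, 'm) dgcat) J' K'.
        dg_functor A T J' \<and> dg_functor C T K' \<and>
        dgfun_eq_on B (dgfun_comp J' F) (dgfun_comp K' G) \<longrightarrow>
        (\<exists>U. dg_functor L T U \<and> dgfun_eq_on A (dgfun_comp U J) J' \<and>
             dgfun_eq_on C (dgfun_comp U K) K' \<and>
             (\<forall>U'. dg_functor L T U' \<and> dgfun_eq_on A (dgfun_comp U' J) J' \<and>
                   dgfun_eq_on C (dgfun_comp U' K) K' \<longrightarrow> dgfun_eq_on L U' U)))"


subsection \<open>The pretriangulated hull\<close>

text \<open>
  A one-sided twisted complex is a list of objects with a matrix of morphisms; the empty list is
  allowed and gives the zero object.  Matrix entries outside the index range are \<open>undefined\<close>, so
  that matrices are equal iff their entries are.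
\<close>

type_synonym ('o, 'm) twisted = "'o list \<times> (nat \<Rightarrow> nat \<Rightarrow> 'm)"

definition mat_of :: "nat \<Rightarrow> nat \<Rightarrow> (nat \<Rightarrow> nat \<Rightarrow> 'm) \<Rightarrow> nat \<Rightarrow> nat \<Rightarrow> 'm" where
  "mat_of a b f = (\<lambda>i j. if i < a \<and> j < b then f i j else undefined)"

definition hom_sum :: "('k, 'o, 'm) dgcat \<Rightarrow> 'o \<Rightarrow> 'o \<Rightarrow> (nat \<Rightarrow> 'm) \<Rightarrow> nat \<Rightarrow> 'm" where
  "hom_sum C x y f n = foldr (\<lambda>k. Add C x y (f k)) [0..<n] (Zero C x y)"

definition mat_Hom :: "('k, 'o, 'm) dgcat \<Rightarrow> 'o list \<Rightarrow> 'o list \<Rightarrow> (nat \<Rightarrow> nat \<Rightarrow> 'm) set" where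
  "mat_Hom C xs ys = {f. \<forall>i j. if i < length xs \<and> j < length ys
     then f i j \<in> Hom C (xs ! i) (ys ! j) else f i j = undefined}"

definition mat_add ::
  "('k, 'o, 'm) dgcat \<Rightarrow> 'o list \<Rightarrow> 'o list
    \<Rightarrow> (nat \<Rightarrow> nat \<Rightarrow> 'm) \<Rightarrow> (nat \<Rightarrow> nat \<Rightarrow> 'm) \<Rightarrow> nat \<Rightarrow> nat \<Rightarrow> 'm" where
  "mat_add C xs ys f g = mat_of (length xs) (length ys)
     (\<lambda>i j. Add C (xs ! i) (ys ! j) (f i j) (g i j))"

definition mat_zero :: "('k, 'o, 'm) dgcat \<Rightarrow> 'o list \<Rightarrow> 'o list \<Rightarrow> nat \<Rightarrow> nat \<Rightarrow> 'm" where
  "mat_zero C xs ys = mat_of (length xs) (length ys) (\<lambda>i j. Zero C (xs ! i) (ys ! j))"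

definition mat_diff ::
  "('k, 'o, 'm) dgcat \<Rightarrow> 'o list \<Rightarrow> 'o list \<Rightarrow> (nat \<Rightarrow> nat \<Rightarrow> 'm) \<Rightarrow> nat \<Rightarrow> nat \<Rightarrow> 'm" where
  "mat_diff C xs ys f = mat_of (length xs) (length ys) (\<lambda>i j. Diff C (xs ! i) (ys ! j) (f i j))"

definition mat_comp ::
  "('k, 'o, 'm) dgcat \<Rightarrow> 'o list \<Rightarrow> 'o list \<Rightarrow> 'o list
    \<Rightarrow> (nat \<Rightarrow> nat \<Rightarrow> 'm) \<Rightarrow> (nat \<Rightarrow> nat \<Rightarrow> 'm) \<Rightarrow> nat \<Rightarrow> nat \<Rightarrow> 'm" where
  "mat_comp C xs ys zs g f = mat_of (length xs) (length zs)
     (\<lambda>i j. hom_sum C (xs ! i) (zs ! j)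
        (\<lambda>k. Comp C (xs ! i) (ys ! k) (zs ! j) (g k j) (f i k)) (length ys))"

definition pretr :: "('k, 'o, 'm) dgcat \<Rightarrow> ('k, ('o, 'm) twisted, nat \<Rightarrow> nat \<Rightarrow> 'm) dgcat" where
  "pretr C =
    \<lparr>Obj = {(xs, p). set xs \<subseteq> Obj C \<and> p \<in> mat_Hom C xs xs \<and>
        (\<forall>i<length xs. \<forall>j\<le>i. p i j = Zero C (xs ! i) (xs ! j)) \<and>
        mat_add C xs xs (mat_diff C xs xs p) (mat_comp C xs xs xs p p) = mat_zero C xs xs},
     Hom = (\<lambda>(xs, p) (ys, q). mat_Hom C xs ys),
     Zero = (\<lambda>(xs, p) (ys, q). mat_zero C xs ys),
     Add = (\<lambda>(xs, p) (ys, q). mat_add C xs ys),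
     Scale = (\<lambda>(xs, p) (ys, q) c f. mat_of (length xs) (length ys)
        (\<lambda>i j. Scale C (xs ! i) (ys ! j) c (f i j))),
     Diff = (\<lambda>(xs, p) (ys, q) f. mat_add C xs ys (mat_diff C xs ys f)
        (mat_add C xs ys (mat_comp C xs ys ys q f) (mat_comp C xs xs ys f p))),
     Idn = (\<lambda>(xs, p). mat_of (length xs) (length xs)
        (\<lambda>i j. if i = j then Idn C (xs ! i) else Zero C (xs ! i) (xs ! j))),
     Comp = (\<lambda>(xs, p) (ys, q) (zs, r). mat_comp C xs ys zs)\<rparr>"


section \<open>Dg categories given by generators and relations\<close>

text \<open>
  Elements of \<open>'e list \<Rightarrow>\<^sub>0 'k\<close> are linear combinations of paths.  A path is the list of its arrows
  in the order in which they are traversed, so the composite \<open>g \<circ> f\<close> corresponds to \<open>f @ g\<close>.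
  A relation \<open>(x, y, r)\<close> imposes \<open>r = 0\<close> in the morphisms from \<open>x\<close> to \<open>y\<close>; the differential is
  given on arrows.
\<close>

record (overloaded) ('v, 'e, 'k) dgpres =
  Verts :: "'v set"
  Arrs :: "'e set"
  Src :: "'e \<Rightarrow> 'v"
  Tgt :: "'e \<Rightarrow> 'v"
  Rels :: "('v \<times> 'v \<times> ('e list \<Rightarrow>\<^sub>0 'k::zero)) set"
  Dgen :: "'e \<Rightarrow> ('e list \<Rightarrow>\<^sub>0 'k)"

fun is_path :: "('v, 'e, 'k::zero) dgpres \<Rightarrow> 'v \<Rightarrow> 'e list \<Rightarrow> 'v \<Rightarrow> bool" where
  "is_path P x [] y \<longleftrightarrow> x \<in> Verts P \<and> x = y"
| "is_path P x (a # p) y \<longleftrightarrow> x \<in> Verts P \<and> a \<in> Arrs P \<and> Src P a = x \<and> is_path P (Tgt P a) p y"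

definition combs :: "('v, 'e, 'k::zero) dgpres \<Rightarrow> 'v \<Rightarrow> 'v \<Rightarrow> ('e list \<Rightarrow>\<^sub>0 'k) set" where
  "combs P x y = {f. \<forall>p\<in>Poly_Mapping.keys f. is_path P x p y}"

abbreviation word :: "'e list \<Rightarrow> ('e list \<Rightarrow>\<^sub>0 'k::zero_neq_one)" where
  "word p \<equiv> Poly_Mapping.single p 1"

definition concat_mult ::
  "('e list \<Rightarrow>\<^sub>0 'k::comm_ring_1) \<Rightarrow> ('e list \<Rightarrow>\<^sub>0 'k) \<Rightarrow> ('e list \<Rightarrow>\<^sub>0 'k)" (infixl \<open>\<odot>\<close> 70) where
  "f \<odot> g = (\<Sum>p\<in>Poly_Mapping.keys f. \<Sum>q\<in>Poly_Mapping.keys g.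
     Poly_Mapping.single (p @ q) (Poly_Mapping.lookup f p * Poly_Mapping.lookup g q))"

definition comb_scale :: "'k::comm_ring_1 \<Rightarrow> ('e list \<Rightarrow>\<^sub>0 'k) \<Rightarrow> ('e list \<Rightarrow>\<^sub>0 'k)" where
  "comb_scale c f = Poly_Mapping.map ((*) c) f"

fun path_diff ::
  "('e \<Rightarrow> ('e list \<Rightarrow>\<^sub>0 'k::comm_ring_1)) \<Rightarrow> 'e list \<Rightarrow> ('e list \<Rightarrow>\<^sub>0 'k)" where
  "path_diff \<delta> [] = 0"
| "path_diff \<delta> (a # p) = \<delta> a \<odot> word p + word [a] \<odot> path_diff \<delta> p"

definition comb_diff ::
  "('e \<Rightarrow> ('e list \<Rightarrow>\<^sub>0 'k::comm_ring_1)) \<Rightarrow> ('e list \<Rightarrow>\<^sub>0 'k) \<Rightarrow> ('e list \<Rightarrow>\<^sub>0 'k)" where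
  "comb_diff \<delta> f = (\<Sum>p\<in>Poly_Mapping.keys f. comb_scale (Poly_Mapping.lookup f p) (path_diff \<delta> p))"

definition comb_push :: "('e \<Rightarrow> 'e2) \<Rightarrow> ('e list \<Rightarrow>\<^sub>0 'k::comm_ring_1) \<Rightarrow> ('e2 list \<Rightarrow>\<^sub>0 'k)" where
  "comb_push \<phi> f =
     (\<Sum>p\<in>Poly_Mapping.keys f. Poly_Mapping.single (map \<phi> p) (Poly_Mapping.lookup f p))"

inductive_set rel_ideal ::
  "('v, 'e, 'k::comm_ring_1) dgpres \<Rightarrow> 'v \<Rightarrow> 'v \<Rightarrow> ('e list \<Rightarrow>\<^sub>0 'k) set"
  for P :: "('v, 'e, 'k) dgpres" and x y :: 'v where
  ri_zero: "0 \<in> rel_ideal P x y"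
| ri_step: "\<lbrakk>f \<in> rel_ideal P x y; (u, v, r) \<in> Rels P; is_path P x p u; is_path P v q y\<rbrakk>
    \<Longrightarrow> f + comb_scale c (word p \<odot> r \<odot> word q) \<in> rel_ideal P x y"

definition comb_class ::
  "('v, 'e, 'k::comm_ring_1) dgpres \<Rightarrow> 'v \<Rightarrow> 'v \<Rightarrow> ('e list \<Rightarrow>\<^sub>0 'k) \<Rightarrow> ('e list \<Rightarrow>\<^sub>0 'k) set" where
  "comb_class P x y f = {g \<in> combs P x y. g - f \<in> rel_ideal P x y}"

text \<open>Operations on classes are unions over representatives, all of which give the same class.\<close>

definition pres_cat ::
  "('v, 'e, 'k::field) dgpres \<Rightarrow> ('k, 'v, ('e list \<Rightarrow>\<^sub>0 'k) set) dgcat" where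
  "pres_cat P =
    \<lparr>Obj = Verts P,
     Hom = (\<lambda>x y. comb_class P x y ` combs P x y),
     Zero = (\<lambda>x y. comb_class P x y 0),
     Add = (\<lambda>x y X Y. \<Union>f\<in>X. \<Union>g\<in>Y. comb_class P x y (f + g)),
     Scale = (\<lambda>x y c X. \<Union>f\<in>X. comb_class P x y (comb_scale c f)),
     Diff = (\<lambda>x y X. \<Union>f\<in>X. comb_class P x y (comb_diff (Dgen P) f)),
     Idn = (\<lambda>x. comb_class P x x (word [])),
     Comp = (\<lambda>x y z Y X. \<Union>f\<in>X. \<Union>g\<in>Y. comb_class P x z (f \<odot> g))\<rparr>"

text \<open>The functor into \<open>pres_cat Q\<close> induced by maps \<open>\<phi>\<close> of vertices and \<open>\<psi>\<close> of arrows.\<close>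

definition pres_functor ::
  "('v2, 'e2, 'k::field) dgpres \<Rightarrow> ('v \<Rightarrow> 'v2) \<Rightarrow> ('e \<Rightarrow> 'e2)
    \<Rightarrow> ('v, ('e list \<Rightarrow>\<^sub>0 'k) set, 'v2, ('e2 list \<Rightarrow>\<^sub>0 'k) set) dgfun" where
  "pres_functor Q \<phi> \<psi> =
    \<lparr>fob = \<phi>, fmo = (\<lambda>x y X. \<Union>f\<in>X. comb_class Q (\<phi> x) (\<phi> y) (comb_push \<psi> f))\<rparr>"


subsection \<open>The triangle dg categories\<close>

datatype tri_obj = T1 | T2 | T3
datatype tri_arr = Th12 | Th23 | Th31 | H21 | H32 | H13

fun tri_src :: "tri_arr \<Rightarrow> tri_obj" where
  "tri_src Th12 = T1" | "tri_src Th23 = T2" | "tri_src Th31 = T3"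
| "tri_src H21 = T2" | "tri_src H32 = T3" | "tri_src H13 = T1"

fun tri_tgt :: "tri_arr \<Rightarrow> tri_obj" where
  "tri_tgt Th12 = T2" | "tri_tgt Th23 = T3" | "tri_tgt Th31 = T1"
| "tri_tgt H21 = T1" | "tri_tgt H32 = T2" | "tri_tgt H13 = T3"

definition Thetas :: "tri_arr set" where
  "Thetas = {Th12, Th23, Th31}"

definition Dprime :: "(tri_obj, tri_arr, 'k::field) dgpres" where
  "Dprime = \<lparr>Verts = UNIV, Arrs = Thetas, Src = tri_src, Tgt = tri_tgt,
     Rels = {}, Dgen = (\<lambda>_. 0)\<rparr>"

fun tri_diff :: "tri_arr \<Rightarrow> (tri_arr list \<Rightarrow>\<^sub>0 'k::field)" where
  "tri_diff H21 = word [Th23, Th31]"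
| "tri_diff H32 = word [Th31, Th12]"
| "tri_diff H13 = word [Th12, Th23]"
| "tri_diff _ = 0"

definition Dbar :: "(tri_obj, tri_arr, 'k::field) dgpres" where
  "Dbar = \<lparr>Verts = UNIV, Arrs = UNIV, Src = tri_src, Tgt = tri_tgt,
     Rels = {(T3, T3, word [H32, Th23] + word [Th31, H13] - word []),
             (T2, T2, word [H21, Th12] + word [Th23, H32] - word []),
             (T1, T1, word [H13, Th31] + word [Th12, H21] - word [])},
     Dgen = tri_diff\<rparr>"

text \<open>
  A factorization of \<open>D' \<rightarrow> \<D>bar\<close> into a semi-free extension \<open>D' \<rightarrow> pres_cat E\<close> (in particular a
  cofibration for the quasi-equivalence model structure) and a quasi-equivalence \<open>w\<close>, both the
  identity on objects.  \<open>E\<close> is free on the three cycles of \<open>D'\<close> and on further arrows \<open>Inr x\<close>, the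
  latter filtered in such a way that the differential of a new arrow only involves arrows of
  strictly smaller rank and those of \<open>D'\<close>.
\<close>

definition semifree_over_Dprime :: "(tri_obj, tri_arr + 'x, 'k::field) dgpres \<Rightarrow> bool" where
  "semifree_over_Dprime E \<longleftrightarrow>
     Verts E = UNIV \<and> Rels E = {} \<and> {a. Inl a \<in> Arrs E} = Thetas \<and>
     (\<forall>a\<in>Thetas. Src E (Inl a) = tri_src a \<and> Tgt E (Inl a) = tri_tgt a \<and> Dgen E (Inl a) = 0) \<and>
     (\<exists>rank :: 'x \<Rightarrow> nat. \<forall>x. Inr x \<in> Arrs E \<longrightarrow>
        Dgen E (Inr x) \<in> combs E (Src E (Inr x)) (Tgt E (Inr x)) \<and>
        comb_diff (Dgen E) (Dgen E (Inr x)) = 0 \<and>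
        (\<forall>p\<in>Poly_Mapping.keys (Dgen E (Inr x)). \<forall>y. Inr y \<in> set p \<longrightarrow> rank y < rank x))"

definition resolves_Dbar ::
  "(tri_obj, tri_arr + 'x, 'k::field) dgpres
    \<Rightarrow> (tri_obj, ((tri_arr + 'x) list \<Rightarrow>\<^sub>0 'k) set, tri_obj, (tri_arr list \<Rightarrow>\<^sub>0 'k) set) dgfun
    \<Rightarrow> bool" where
  "resolves_Dbar E w \<longleftrightarrow>
     semifree_over_Dprime E \<and>
     quasi_equivalence (pres_cat E) (pres_cat (Dbar :: (tri_obj, tri_arr, 'k) dgpres)) w \<and>
     (\<forall>x. fob w x = x) \<and>
     dgfun_eq_on (pres_cat (Dprime :: (tri_obj, tri_arr, 'k) dgpres))
       (dgfun_comp w (pres_functor E id Inl)) (pres_functor Dbar id id)"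


section \<open>Pointed oriented surfaces\<close>

text \<open>
  Surfaces are topological, with charts in the closed upper half-plane.  The arcs, curves and
  isotopies of surface topology are taken in the topological category; in dimension two all
  embedded curves are tame.
\<close>

record 'a surface =
  Space :: "'a topology"
  Charts :: "('a set \<times> ('a \<Rightarrow> complex)) set"
  Bases :: "'a list"

text \<open>An injective continuous map is orientation preserving at \<open>z\<close> iff its local degree is \<open>1\<close>.\<close>

definition orient_pres_at :: "(complex \<Rightarrow> complex) \<Rightarrow> complex \<Rightarrow> bool" where
  "orient_pres_at f z \<longleftrightarrow>
     (\<exists>\<epsilon>>0. \<forall>r. 0 < r \<and> r < \<epsilon> \<longrightarrow> winding_number (f \<circ> circlepath z r) (f z) = 1)"

definition is_chart :: "'a topology \<Rightarrow> 'a set \<Rightarrow> ('a \<Rightarrow> complex) \<Rightarrow> bool" where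
  "is_chart X U c \<longleftrightarrow> openin X U \<and> openin (top_of_set {z. 0 \<le> Im z}) (c ` U) \<and>
     homeomorphic_map (subtopology X U) (top_of_set (c ` U)) c"

definition bdry :: "'a surface \<Rightarrow> 'a set" where
  "bdry S = {x. \<exists>(U, c)\<in>Charts S. x \<in> U \<and> Im (c x) = 0}"

definition pointed_surface :: "'a surface \<Rightarrow> bool" where
  "pointed_surface S \<longleftrightarrow>
     topspace (Space S) \<noteq> {} \<and>
     compact_space (Space S) \<and> connected_space (Space S) \<and> Hausdorff_space (Space S) \<and>
     (\<forall>(U, c)\<in>Charts S. is_chart (Space S) U c) \<and>
     (\<Union>(U, c)\<in>Charts S. U) = topspace (Space S) \<and>
     (\<forall>(U, c)\<in>Charts S. \<forall>(V, d)\<in>Charts S. \<forall>x\<in>U \<inter> V.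
        0 < Im (c x) \<longrightarrow> orient_pres_at (d \<circ> inv_into U c) (c x)) \<and>
     set (Bases S) \<subseteq> bdry S \<and>
     bij_betw (\<lambda>i. connected_component_of_set (subtopology (Space S) (bdry S)) (Bases S ! i))
       {..<length (Bases S)} (connected_components_of (subtopology (Space S) (bdry S)))"

definition marking :: "'a surface \<Rightarrow> 'a set \<Rightarrow> bool" where
  "marking S m \<longleftrightarrow> finite m \<and> m \<subseteq> bdry S - set (Bases S) \<and>
     (bdry S \<noteq> {} \<longrightarrow> even (card m) \<and> 2 \<le> card m)"


subsection \<open>Dividing sets and isotopies\<close>

record 'a divset =
  Curve :: "'a set"
  RPos :: "'a set"
  RNeg :: "'a set"

definition embedded_arc :: "'a topology \<Rightarrow> 'a set \<Rightarrow> 'a \<Rightarrow> 'a \<Rightarrow> bool" where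
  "embedded_arc X A a b \<longleftrightarrow>
     (\<exists>g. embedding_map (top_of_set {0..1::real}) X g \<and> g ` {0..1} = A \<and> g 0 = a \<and> g 1 = b)"

definition embedded_circle :: "'a topology \<Rightarrow> 'a set \<Rightarrow> bool" where
  "embedded_circle X A \<longleftrightarrow>
     (\<exists>g. embedding_map (top_of_set (sphere (0::complex) 1)) X g \<and> g ` sphere 0 1 = A)"

definition multicurve :: "'a surface \<Rightarrow> 'a set \<Rightarrow> bool" where
  "multicurve S \<gamma> \<longleftrightarrow> (\<exists>\<C>. finite \<C> \<and> pairwise disjnt \<C> \<and> \<Union>\<C> = \<gamma> \<and>
     (\<forall>A\<in>\<C>. (embedded_circle (Space S) A \<and> A \<inter> bdry S = {}) \<or>
             (\<exists>a b. embedded_arc (Space S) A a b \<and> A \<inter> bdry S = {a, b})))"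

text \<open>
  The boundary of a region relative to \<open>\<partial>\<Sigma>\<close>, including the endpoints of \<open>\<gamma>\<close>, is its topological
  frontier in \<open>\<Sigma>\<close>.
\<close>

definition dividing_set :: "'a surface \<Rightarrow> 'a set \<Rightarrow> 'a divset \<Rightarrow> bool" where
  "dividing_set S m D \<longleftrightarrow>
     Curve D \<noteq> {} \<and> multicurve S (Curve D) \<and> Curve D \<inter> bdry S = m \<and>
     openin (Space S) (RPos D) \<and> openin (Space S) (RNeg D) \<and> RPos D \<inter> RNeg D = {} \<and>
     RPos D \<union> RNeg D = topspace (Space S) - Curve D \<and>
     Space S frontier_of RPos D = Curve D \<and> Space S frontier_of RNeg D = Curve D"

definition ambient_isotopy :: "'a surface \<Rightarrow> 'a set \<Rightarrow> (real \<Rightarrow> 'a \<Rightarrow> 'a) \<Rightarrow> bool" where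
  "ambient_isotopy S m H \<longleftrightarrow>
     continuous_map (prod_topology (top_of_set {0..1}) (Space S)) (Space S) (\<lambda>(t, x). H t x) \<and>
     (\<forall>t\<in>{0..1}. homeomorphic_map (Space S) (Space S) (H t)) \<and>
     (\<forall>x\<in>topspace (Space S). H 0 x = x) \<and>
     (\<forall>t\<in>{0..1}. \<forall>x\<in>set (Bases S) \<union> m. H t x = x)"

definition carries :: "('a \<Rightarrow> 'a) \<Rightarrow> 'a divset \<Rightarrow> 'a divset \<Rightarrow> bool" where
  "carries h D D' \<longleftrightarrow>
     h ` Curve D = Curve D' \<and> h ` RPos D = RPos D' \<and> h ` RNeg D = RNeg D'"

definition divset_class :: "'a surface \<Rightarrow> 'a set \<Rightarrow> 'a divset \<Rightarrow> 'a divset set" where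
  "divset_class S m D =
     {D'. dividing_set S m D' \<and> (\<exists>H. ambient_isotopy S m H \<and> carries (H 1) D D')}"


subsection \<open>Bypass moves\<close>

definition rect :: "complex set" where
  "rect = {z. \<bar>Re z\<bar> \<le> 1 \<and> \<bar>Im z\<bar> \<le> 2}"

text \<open>
  \<open>\<phi>\<close> identifies \<open>rect\<close> with a neighbourhood of an equator on \<open>D\<close>.  The existence of \<open>\<phi>\<close> expresses
  that the arc \<open>equator \<phi>\<close> meets the curve transversally in exactly three points, two of which are
  its endpoints.
\<close>

definition bypass_chart :: "'a surface \<Rightarrow> 'a divset \<Rightarrow> (complex \<Rightarrow> 'a) \<Rightarrow> bool" where
  "bypass_chart S D \<phi> \<longleftrightarrow>
     embedding_map (top_of_set rect) (Space S) \<phi> \<and> \<phi> ` rect \<inter> bdry S = {} \<and>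
     (\<forall>z\<in>interior rect. \<forall>(U, c)\<in>Charts S. \<phi> z \<in> U \<longrightarrow> orient_pres_at (c \<circ> \<phi>) z) \<and>
     {z\<in>rect. \<phi> z \<in> Curve D} = {z\<in>rect. Im z \<in> {-1, 0, 1}}"

definition equator :: "(complex \<Rightarrow> 'a) \<Rightarrow> 'a set" where
  "equator \<phi> = \<phi> ` {z. Re z = 0 \<and> \<bar>Im z\<bar> \<le> 1}"

definition rect_arc :: "complex set \<Rightarrow> complex \<Rightarrow> complex \<Rightarrow> bool" where
  "rect_arc A a b \<longleftrightarrow> A \<subseteq> rect \<and> A \<inter> frontier rect = {a, b} \<and>
     (\<exists>g. arc g \<and> path_image g = A \<and> pathstart g = a \<and> pathfinish g = b)"

text \<open>\<open>A1\<close> joins \<open>R\<^sub>1\<close> to \<open>R\<^sub>0\<close>, \<open>A2\<close> joins \<open>L\<^sub>0\<close> to \<open>L\<^sub>-\<^sub>1\<close> and \<open>A3\<close> joins \<open>L\<^sub>1\<close> to \<open>R\<^sub>-\<^sub>1\<close>.\<close>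

definition bypass_arcs :: "complex set \<Rightarrow> complex set \<Rightarrow> complex set \<Rightarrow> bool" where
  "bypass_arcs A1 A2 A3 \<longleftrightarrow>
     rect_arc A1 (Complex 1 1) (Complex 1 0) \<and>
     rect_arc A2 (Complex (-1) 0) (Complex (-1) (-1)) \<and>
     rect_arc A3 (Complex (-1) 1) (Complex 1 (-1)) \<and>
     A1 \<inter> A2 = {} \<and> A1 \<inter> A3 = {} \<and> A2 \<inter> A3 = {}"

definition bypass_via ::
  "'a surface \<Rightarrow> 'a set \<Rightarrow> 'a divset \<Rightarrow> (complex \<Rightarrow> 'a)
    \<Rightarrow> complex set \<Rightarrow> complex set \<Rightarrow> complex set \<Rightarrow> 'a divset \<Rightarrow> bool" where
  "bypass_via S m D \<phi> A1 A2 A3 D' \<longleftrightarrow>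
     dividing_set S m D \<and> dividing_set S m D' \<and> bypass_chart S D \<phi> \<and> bypass_arcs A1 A2 A3 \<and>
     Curve D' \<inter> \<phi> ` rect = \<phi> ` (A1 \<union> A2 \<union> A3) \<and>
     Curve D' - \<phi> ` rect = Curve D - \<phi> ` rect \<and>
     RPos D' - \<phi> ` rect = RPos D - \<phi> ` rect \<and>
     RNeg D' - \<phi> ` rect = RNeg D - \<phi> ` rect"

definition bypass ::
  "'a surface \<Rightarrow> 'a set \<Rightarrow> 'a divset \<Rightarrow> (complex \<Rightarrow> 'a) \<Rightarrow> 'a divset \<Rightarrow> bool" where
  "bypass S m D \<phi> D' \<longleftrightarrow> (\<exists>A1 A2 A3. bypass_via S m D \<phi> A1 A2 A3 D')"

text \<open>
  The isotopy class of a bypass move is the isotopy class of the dividing set together with the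
  equator.  A generator records this class along with the classes of its source and target.
\<close>

definition equator_class ::
  "'a surface \<Rightarrow> 'a set \<Rightarrow> 'a divset \<Rightarrow> 'a set \<Rightarrow> ('a divset \<times> 'a set) set" where
  "equator_class S m D l = {(D', l'). dividing_set S m D' \<and>
     (\<exists>H. ambient_isotopy S m H \<and> carries (H 1) D D' \<and> H 1 ` l = l')}"

type_synonym 'a bypass_gen = "'a divset set \<times> ('a divset \<times> 'a set) set \<times> 'a divset set"

definition bypass_gen ::
  "'a surface \<Rightarrow> 'a set \<Rightarrow> 'a divset \<Rightarrow> (complex \<Rightarrow> 'a) \<Rightarrow> 'a divset \<Rightarrow> 'a bypass_gen" where
  "bypass_gen S m D \<phi> D' =
     (divset_class S m D, equator_class S m D (equator \<phi>), divset_class S m D')"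

definition gen_src :: "'a bypass_gen \<Rightarrow> 'a divset set" where
  "gen_src e = fst e"

definition gen_tgt :: "'a bypass_gen \<Rightarrow> 'a divset set" where
  "gen_tgt e = snd (snd e)"

text \<open>
  \<open>E\<close> is an embedded half-disk bounded by the segment \<open>\<phi> ` I\<close> of the equator and an arc of the
  dividing curve.
\<close>

definition cap ::
  "'a surface \<Rightarrow> 'a divset \<Rightarrow> (complex \<Rightarrow> 'a) \<Rightarrow> complex set \<Rightarrow> 'a set \<Rightarrow> bool" where
  "cap S D \<phi> I E \<longleftrightarrow>
     (\<exists>\<psi> A a b. embedding_map (top_of_set (cball (0::complex) 1)) (Space S) \<psi> \<and>
        E = \<psi> ` cball 0 1 \<and> embedded_arc (Space S) A a b \<and> A \<subseteq> Curve D \<and>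
        \<psi> ` sphere 0 1 = \<phi> ` I \<union> A \<and> \<psi> ` ball 0 1 \<inter> Curve D = {} \<and> E \<inter> equator \<phi> = \<phi> ` I)"

text \<open>
  A cap leaves its segment to the left (right) iff it contains the part of the rectangle adjacent
  to the segment on that side and between the two strands of the dividing curve.
\<close>

definition nw_capped :: "'a surface \<Rightarrow> 'a divset \<Rightarrow> (complex \<Rightarrow> 'a) \<Rightarrow> bool" where
  "nw_capped S D \<phi> \<longleftrightarrow> (\<exists>E. cap S D \<phi> {z. Re z = 0 \<and> 0 \<le> Im z \<and> Im z \<le> 1} E \<and>
     \<phi> ` {z. -1 < Re z \<and> Re z < 0 \<and> 0 < Im z \<and> Im z < 1} \<subseteq> E)"

definition se_capped :: "'a surface \<Rightarrow> 'a divset \<Rightarrow> (complex \<Rightarrow> 'a) \<Rightarrow> bool" where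
  "se_capped S D \<phi> \<longleftrightarrow> (\<exists>E. cap S D \<phi> {z. Re z = 0 \<and> -1 \<le> Im z \<and> Im z \<le> 0} E \<and>
     \<phi> ` {z. 0 < Re z \<and> Re z < 1 \<and> -1 < Im z \<and> Im z < 0} \<subseteq> E)"

text \<open>Two equators define the same bypass move on \<open>D\<close>: they are isotopic with endpoints in \<open>\<gamma>\<close>.\<close>

definition same_on :: "'a surface \<Rightarrow> 'a set \<Rightarrow> 'a divset \<Rightarrow> 'a set \<Rightarrow> 'a set \<Rightarrow> bool" where
  "same_on S m D l l' \<longleftrightarrow> (\<exists>H. ambient_isotopy S m H \<and>
     (\<forall>t\<in>{0..1}. H t ` Curve D = Curve D) \<and> H 1 ` l = l')"


section \<open>The formal contact category\<close>

text \<open>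
  In a capped relation the source and target classes always agree; the equation is part of the
  set comprehension only to make the relation well typed.  Since generators are isotopy classes,
  the commutation relation is stated for disjoint representatives of the two equators, with
  disjoint rectangles, so that the moves can be performed in either order.
\<close>

definition PreKo :: "'a surface \<Rightarrow> 'a set \<Rightarrow> ('a divset set, 'a bypass_gen, 'k::field) dgpres" where
  "PreKo S m =
    \<lparr>Verts = divset_class S m ` {D. dividing_set S m D},
     Arrs = {bypass_gen S m D \<phi> D' |D \<phi> D'. bypass S m D \<phi> D'},
     Src = gen_src, Tgt = gen_tgt,
     Rels =
       {(divset_class S m D, divset_class S m D, word [bypass_gen S m D \<phi> D'] - word [])
         |D \<phi> D'. bypass S m D \<phi> D' \<and> (nw_capped S D \<phi> \<or> se_capped S D \<phi>) \<and>
           divset_class S m D' = divset_class S m D} \<union>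
       {(divset_class S m D, divset_class S m D12,
           word [bypass_gen S m D \<phi>1 D1, bypass_gen S m D1 \<phi>2 D12] -
           word [bypass_gen S m D \<phi>2 D2, bypass_gen S m D2 \<phi>1 D12])
         |D \<phi>1 \<phi>2 D1 D2 D12.
           bypass S m D \<phi>1 D1 \<and> bypass S m D1 \<phi>2 D12 \<and>
           bypass S m D \<phi>2 D2 \<and> bypass S m D2 \<phi>1 D12 \<and>
           \<phi>1 ` rect \<inter> \<phi>2 ` rect = {} \<and> \<not> same_on S m D (equator \<phi>1) (equator \<phi>2)},
     Dgen = (\<lambda>_. 0)\<rparr>"

text \<open>
  \<open>\<phi>'\<close> is a chart around the equator inside the rectangle of \<open>\<phi>\<close> which crosses each of the three
  new arcs once.
\<close>

definition next_equator ::
  "(complex \<Rightarrow> 'a) \<Rightarrow> complex set \<Rightarrow> complex set \<Rightarrow> complex set \<Rightarrow> (complex \<Rightarrow> 'a) \<Rightarrow> bool" where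
  "next_equator \<phi> A1 A2 A3 \<phi>' \<longleftrightarrow> equator \<phi>' \<subseteq> \<phi> ` interior rect \<and>
     (\<forall>A\<in>{A1, A2, A3}. card (equator \<phi>' \<inter> \<phi> ` A) = 1)"

text \<open>
  The bypass triangles \<open>(\<theta>\<^sub>A, \<theta>\<^sub>B, \<theta>\<^sub>C)\<close>.  Each is determined by \<open>\<theta>\<^sub>A\<close>, so this set serves as the index
  set of bypass moves in the coproducts below.
\<close>

definition bypass_triangles ::
  "'a surface \<Rightarrow> 'a set \<Rightarrow> ('a bypass_gen \<times> 'a bypass_gen \<times> 'a bypass_gen) set" where
  "bypass_triangles S m =
     {(bypass_gen S m DA \<phi>A DB, bypass_gen S m DB \<phi>B DC, bypass_gen S m DC \<phi>C DA')
       |DA \<phi>A A1 A2 A3 DB \<phi>B B1 B2 B3 DC \<phi>C DA'.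
         bypass_via S m DA \<phi>A A1 A2 A3 DB \<and> next_equator \<phi>A A1 A2 A3 \<phi>B \<and>
         bypass_via S m DB \<phi>B B1 B2 B3 DC \<and> next_equator \<phi>B B1 B2 B3 \<phi>C \<and>
         bypass S m DC \<phi>C DA' \<and> divset_class S m DA' = divset_class S m DA}"

definition triangle_functor ::
  "'a surface \<Rightarrow> 'a set \<Rightarrow> 'a bypass_gen \<times> 'a bypass_gen \<times> 'a bypass_gen
    \<Rightarrow> (tri_obj, (tri_arr list \<Rightarrow>\<^sub>0 'k::field) set,
        'a divset set, ('a bypass_gen list \<Rightarrow>\<^sub>0 'k) set) dgfun" where
  "triangle_functor S m = (\<lambda>(eA, eB, eC). pres_functor (PreKo S m)
     (\<lambda>x. case x of T1 \<Rightarrow> gen_src eA | T2 \<Rightarrow> gen_src eB | T3 \<Rightarrow> gen_src eC)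
     (\<lambda>a. case a of Th12 \<Rightarrow> eA | Th23 \<Rightarrow> eB | Th31 \<Rightarrow> eC | _ \<Rightarrow> undefined))"

definition Xi ::
  "'a surface \<Rightarrow> 'a set
    \<Rightarrow> (('a bypass_gen \<times> 'a bypass_gen \<times> 'a bypass_gen) \<times> tri_obj,
        (tri_arr list \<Rightarrow>\<^sub>0 'k::field) set,
        'a divset set, ('a bypass_gen list \<Rightarrow>\<^sub>0 'k) set) dgfun" where
  "Xi S m = cotuple (pres_cat (PreKo S m)) (triangle_functor S m)"

text \<open>
  \<open>L\<close> is a homotopy pushout of \<open>Xi\<close> along the copower of \<open>D' \<rightarrow> \<D>bar\<close>: the map \<open>D' \<rightarrow> \<D>bar\<close> is
  replaced by the cofibration \<open>D' \<rightarrow> pres_cat E\<close>, and the strict pushout is taken.  (Over a field the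
  quasi-equivalence model structure is left proper, so \<open>Pre-Ko\<close> need not be replaced.)  As the
  second leg is bijective on objects, so is \<open>J\<close>, which is normalized to be the identity on objects:
  the objects of \<open>L\<close> are the isotopy classes of dividing sets.
\<close>

definition is_L_Xi ::
  "'a surface \<Rightarrow> 'a set \<Rightarrow> ('k::field, 'a divset set, 'm) dgcat
    \<Rightarrow> (tri_obj, tri_arr + 'x, 'k) dgpres
    \<Rightarrow> (tri_obj, ((tri_arr + 'x) list \<Rightarrow>\<^sub>0 'k) set, tri_obj, (tri_arr list \<Rightarrow>\<^sub>0 'k) set) dgfun
    \<Rightarrow> bool" where
  "is_L_Xi S m L E w \<longleftrightarrow> resolves_Dbar E w \<and>
     (\<exists>J K. is_dg_pushout
        (dg_copower (bypass_triangles S m) (pres_cat Dprime))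
        (pres_cat (PreKo S m))
        (dg_copower (bypass_triangles S m) (pres_cat E))
        (Xi S m) (copower_map (pres_functor E id Inl)) L J K \<and>
      Obj L = Verts (PreKo S m :: (_, _, 'k) dgpres) \<and> (\<forall>x\<in>Obj L. fob J x = x))"

definition Ko :: "('k, 'a divset set, 'm) dgcat
    \<Rightarrow> ('k, ('a divset set, 'm) twisted, nat \<Rightarrow> nat \<Rightarrow> 'm) dgcat" where
  "Ko L = pretr L"

definition pos_classes :: "'a surface \<Rightarrow> 'a set \<Rightarrow> 'a divset set set" where
  "pos_classes S m = divset_class S m ` {D. dividing_set S m D \<and> Bases S ! 0 \<in> RPos D}"

definition neg_classes :: "'a surface \<Rightarrow> 'a set \<Rightarrow> 'a divset set set" where
  "neg_classes S m = divset_class S m ` {D. dividing_set S m D \<and> Bases S ! 0 \<in> RNeg D}"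

definition Ko_plus :: "'a surface \<Rightarrow> 'a set \<Rightarrow> ('k, 'a divset set, 'm) dgcat
    \<Rightarrow> ('k, ('a divset set, 'm) twisted, nat \<Rightarrow> nat \<Rightarrow> 'm) dgcat" where
  "Ko_plus S m L = full_subcat (Ko L) {(xs, p). set xs \<subseteq> pos_classes S m}"

definition Ko_minus :: "'a surface \<Rightarrow> 'a set \<Rightarrow> ('k, 'a divset set, 'm) dgcat
    \<Rightarrow> ('k, ('a divset set, 'm) twisted, nat \<Rightarrow> nat \<Rightarrow> 'm) dgcat" where
  "Ko_minus S m L = full_subcat (Ko L) {(xs, p). set xs \<subseteq> neg_classes S m}"

end

theory Submission
  imports Defs
begin

text \<open>
  The basepoint \<open>z\<^sub>1\<close> is fixed by isotopies and lies on \<open>\<partial>\<Sigma>\<close>, away from the rectangles of bypass moves.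
  Hence no bypass move and no bypass triangle connects a dividing set that is positive at \<open>z\<^sub>1\<close>
  with one that is negative there.  By the universal property of the pushout the two
  families of objects of \<open>L\<close> are then orthogonal, so a twisted complex over \<open>L\<close> is the direct sum
  of its positive and its negative block, and every morphism is block diagonal.  Passing to the
  two blocks is a dg functor which is bijective on morphism complexes and surjective on objects.
\<close>

section \<open>Dg categories and quasi-equivalences\<close>

text \<open>\<open>L\<close> is known only through a universal property, not through explicit
  morphisms, so the orthogonality of the two signs cannot be read off from generators. That property
  is tested only on dg categories with the carrier types of \<open>L\<close>; the category used to
  test it is therefore built on the objects and morphisms of \<open>L\<close> itself.

  The comparison functor goes from \<open>Ko L\<close> to the product because restriction to a block
  makes sense strictly for every twisted complex. Writing a complex as the concatenation of its two
  blocks would instead require reordering its list. For the same reason restriction is not an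
  isomorphism of dg categories in general: complexes that interleave the same two blocks differently
  have the same image. It is still a strict quasi-equivalence, so a single formal inverse suffices
  in Hqe.

  Characteristic 2 enters in the twisted differential, whose square and Leibniz rule hold because
  repeated summands cancel.\<close>

context dg_category
begin

lemmas closed = zero_closed add_closed scale_closed idn_closed comp_closed diff_closed

lemma zero_add: "\<lbrakk>x \<in> Obj C; y \<in> Obj C; f \<in> Hom C x y\<rbrakk> \<Longrightarrow> Add C x y (Zero C x y) f = f"
  by (metis add_commute add_zero zero_closed)

lemma add_left_commute:
  "\<lbrakk>x \<in> Obj C; y \<in> Obj C; f \<in> Hom C x y; g \<in> Hom C x y; h \<in> Hom C x y\<rbrakk>
    \<Longrightarrow> Add C x y f (Add C x y g h) = Add C x y g (Add C x y f h)"
  by (metis add_assoc add_commute)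

lemma add_left_cancel:
  assumes "x \<in> Obj C" "y \<in> Obj C" "f \<in> Hom C x y" "g \<in> Hom C x y" "h \<in> Hom C x y"
    and "Add C x y f g = Add C x y f h"
  shows "g = h"
  by (metis add_assoc add_commute add_inverse assms zero_add)

text \<open>An additive map sends zero to an element \<open>f\<close> with \<open>f + f = f\<close>.
  This one criterion therefore yields all the vanishing laws for structure maps and dg
  functors.\<close>

lemma add_idem_zero:
  "\<lbrakk>x \<in> Obj C; y \<in> Obj C; f \<in> Hom C x y; Add C x y f f = f\<rbrakk> \<Longrightarrow> f = Zero C x y"
  by (metis add_left_cancel add_zero zero_closed)

lemma zero_scale: "\<lbrakk>x \<in> Obj C; y \<in> Obj C; f \<in> Hom C x y\<rbrakk> \<Longrightarrow> Scale C x y 0 f = Zero C x y"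
  by (rule add_idem_zero) (simp_all add: scale_closed flip: add_scale)

lemma scale_zero: "\<lbrakk>x \<in> Obj C; y \<in> Obj C\<rbrakk> \<Longrightarrow> Scale C x y c (Zero C x y) = Zero C x y"
  by (rule add_idem_zero) (simp_all add: closed add_zero flip: scale_add)

lemma diff_zero: "\<lbrakk>x \<in> Obj C; y \<in> Obj C\<rbrakk> \<Longrightarrow> Diff C x y (Zero C x y) = Zero C x y"
  by (rule add_idem_zero) (simp_all add: closed add_zero flip: diff_add)

lemma comp_zero_right:
  "\<lbrakk>x \<in> Obj C; y \<in> Obj C; z \<in> Obj C; g \<in> Hom C y z\<rbrakk>
    \<Longrightarrow> Comp C x y z g (Zero C x y) = Zero C x z"
  by (rule add_idem_zero) (simp_all add: closed add_zero flip: comp_add_right)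

lemma comp_zero_left:
  "\<lbrakk>x \<in> Obj C; y \<in> Obj C; z \<in> Obj C; f \<in> Hom C x y\<rbrakk>
    \<Longrightarrow> Comp C x y z (Zero C y z) f = Zero C x z"
  by (rule add_idem_zero) (simp_all add: closed add_zero flip: comp_add_left)

text \<open>Negation is not part of the structure of a dg category; scaling by \<open>-1\<close>
  provides an explicit inverse.\<close>

lemma add_minus:
  "\<lbrakk>x \<in> Obj C; y \<in> Obj C; f \<in> Hom C x y\<rbrakk> \<Longrightarrow> Add C x y f (Scale C x y (-1) f) = Zero C x y"
  using add_scale[of x y f 1 "-1"] by (simp add: scale_one zero_scale)

lemma dg_functor_zero:
  assumes "dg_functor C B F" "x \<in> Obj C" "y \<in> Obj C"
  shows "fmo F x y (Zero C x y) = Zero B (fob F x) (fob F y)"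
proof -
  interpret F: dg_functor C B F by fact
  show ?thesis
    by (rule F.B.add_idem_zero)
      (use assms in \<open>simp_all add: F.fob_closed F.fmo_closed zero_closed add_zero flip: F.fmo_add\<close>)
qed

text \<open>\<open>HoHom\<close> is a quotient by this relation; being an equivalence lets equality
  of classes be tested on representatives.\<close>

lemma equiv_homologous:
  assumes "x \<in> Obj C" "y \<in> Obj C"
  shows "equiv (cycles C x y) (homologous C x y)"
proof (rule equivI)
  show "homologous C x y \<subseteq> cycles C x y \<times> cycles C x y"
    by (auto simp: homologous_def)
  show "refl_on (cycles C x y) (homologous C x y)"
    using assms
    by (auto simp: homologous_def refl_on_def cycles_def diff_zero add_zero
        intro!: bexI[of _ "Zero C x y"] zero_closed)
  show "sym (homologous C x y)"
  proof (rule symI)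
    fix f g assume "(f, g) \<in> homologous C x y"
    then obtain h where h: "f \<in> cycles C x y" "g \<in> cycles C x y" "h \<in> Hom C x y"
      "f = Add C x y g (Diff C x y h)"
      by (auto simp: homologous_def)
    then have "g = Add C x y f (Diff C x y (Scale C x y (-1) h))"
      using assms by (simp add: cycles_def closed add_assoc diff_scale add_minus add_zero)
    with h assms show "(g, f) \<in> homologous C x y"
      unfolding homologous_def by (blast intro: scale_closed)
  qed
  show "trans (homologous C x y)"
  proof (rule transI)
    fix f g k assume "(f, g) \<in> homologous C x y" "(g, k) \<in> homologous C x y"
    then obtain h h' where h: "f \<in> cycles C x y" "g \<in> cycles C x y" "k \<in> cycles C x y"
      "h \<in> Hom C x y" "f = Add C x y g (Diff C x y h)"
      "h' \<in> Hom C x y" "g = Add C x y k (Diff C x y h')"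
      by (auto simp: homologous_def)
    then have "f = Add C x y k (Diff C x y (Add C x y h' h))"
      using assms by (simp add: cycles_def closed add_assoc diff_add)
    with h assms show "(f, k) \<in> homologous C x y"
      unfolding homologous_def by (blast intro: add_closed)
  qed
qed

lemma Ho_isomorphic_refl:
  assumes "x \<in> Obj C"
  shows "Ho_isomorphic C x x"
proof -
  \<comment> \<open>The Leibniz rule for \<open>1 = 1 1\<close> gives \<open>d1 = d1 + d1\<close>,
    so the identity is a cycle.\<close>
  have "Add C x x (Diff C x x (Idn C x)) (Diff C x x (Idn C x)) = Diff C x x (Idn C x)"
    using leibniz[of x x x "Idn C x" "Idn C x"] assms
    by (simp add: closed comp_idn idn_comp)
  then have "Idn C x \<in> cycles C x x"
    using assms by (simp add: cycles_def closed add_idem_zero)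
  moreover then have "(Idn C x, Idn C x) \<in> homologous C x x"
    using equiv_homologous[OF assms assms] by (meson equivE refl_onD)
  ultimately show ?thesis
    using assms unfolding Ho_isomorphic_def by (force simp: idn_comp idn_closed)
qed

end

locale dg_category_char2 = dg_category C for C :: "('k::field, 'o, 'm) dgcat" +
  assumes char2: "CHAR('k) = 2"
begin

text \<open>This is the form in which characteristic 2 is applied: each morphism is its own
  negative.\<close>

lemma add_self:
  assumes "x \<in> Obj C" "y \<in> Obj C" "f \<in> Hom C x y"
  shows "Add C x y f f = Zero C x y"
proof -
  have "(1::'k) + 1 = 0"
    using of_nat_CHAR[where 'a='k] char2 by simp
  then show ?thesis
    using add_scale[of x y f 1 1] assms by (simp add: scale_one zero_scale)
qed

end

section \<open>From bijections of morphism complexes to quasi-equivalences\<close>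

lemma (in dg_functor) quasi_equivalence_if_bij:
  assumes bij: "\<And>x y. \<lbrakk>x \<in> Obj A; y \<in> Obj A\<rbrakk>
      \<Longrightarrow> bij_betw (fmo F x y) (Hom A x y) (Hom B (fob F x) (fob F y))"
    and surj: "Obj B \<subseteq> fob F ` Obj A"
  shows "quasi_equivalence A B F"
proof unfold_locales
  fix x y assume xy: "x \<in> Obj A" "y \<in> Obj A"
  let ?F = "fmo F x y" and ?x = "fob F x" and ?y = "fob F y"
  have FO: "?x \<in> Obj B" "?y \<in> Obj B" using xy by (auto intro: fob_closed)
  note eqA = A.equiv_homologous[OF xy] and eqB = B.equiv_homologous[OF FO]
  have inj: "?F f = ?F g \<longleftrightarrow> f = g" if "f \<in> Hom A x y" "g \<in> Hom A x y" for f g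
    using bij[OF xy] that by (auto simp: bij_betw_def inj_on_def)
  have Fzero: "?F (Zero A x y) = Zero B ?x ?y"
    using A.dg_functor_zero[OF dg_functor_axioms xy] .
  have cyc: "?F f \<in> cycles B ?x ?y \<longleftrightarrow> f \<in> cycles A x y" if "f \<in> Hom A x y" for f
    using that xy inj[of "Diff A x y f" "Zero A x y"]
    by (auto simp: cycles_def fmo_closed A.closed Fzero fmo_diff)
  \<comment> \<open>Every bounding chain in \<open>B\<close> has the form \<open>?F h\<close> by
    surjectivity; injectivity then removes \<open>?F\<close> from the equation.\<close>
  have hom: "(?F f, ?F g) \<in> homologous B ?x ?y \<longleftrightarrow> (f, g) \<in> homologous A x y"
    if f: "f \<in> Hom A x y" and g: "g \<in> Hom A x y" for f g
  proof -
    have "(\<exists>k\<in>Hom B ?x ?y. ?F f = Add B ?x ?y (?F g) (Diff B ?x ?y k)) \<longleftrightarrow>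
        (\<exists>h\<in>Hom A x y. ?F f = Add B ?x ?y (?F g) (Diff B ?x ?y (?F h)))"
      by (simp flip: bij_betw_imp_surj_on[OF bij[OF xy]])
    also have "\<dots> \<longleftrightarrow> (\<exists>h\<in>Hom A x y. f = Add A x y g (Diff A x y h))"
      using xy f g by (intro bex_cong refl)
        (simp add: inj A.closed flip: fmo_diff fmo_add)
    finally show ?thesis using cyc f g by (simp add: homologous_def)
  qed
  have cycH: "f \<in> Hom A x y" if "f \<in> cycles A x y" for f using that by (simp add: cycles_def)
  \<comment> \<open>\<open>Ho_map\<close> saturates the image of a whole class; since
    \<open>?F\<close> preserves homology, the result is the class of the image of any
    representative.\<close>
  have Ho: "Ho_map B F x y (homologous A x y `` {f}) = homologous B ?x ?y `` {?F f}"
    if f: "f \<in> cycles A x y" for f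
  proof -
    have "(?F f, ?F g) \<in> homologous B ?x ?y" if "(f, g) \<in> homologous A x y" for g
      using that hom cycH by (auto simp: homologous_def)
    moreover have "(f, f) \<in> homologous A x y"
      using eqA f by (meson equivE refl_onD)
    ultimately show ?thesis
      unfolding Ho_map_def using eqB
      by (auto simp: equiv_def dest: symD transD)
  qed
  show "bij_betw (Ho_map B F x y) (HoHom A x y) (HoHom B ?x ?y)"
    unfolding bij_betw_def
  proof
    show "inj_on (Ho_map B F x y) (HoHom A x y)"
    proof (rule inj_onI)
      fix X Y
      assume "X \<in> HoHom A x y" "Y \<in> HoHom A x y" and eq: "Ho_map B F x y X = Ho_map B F x y Y"
      then obtain f g where fg: "f \<in> cycles A x y" "X = homologous A x y `` {f}"
        "g \<in> cycles A x y" "Y = homologous A x y `` {g}"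
        by (auto simp: HoHom_def quotient_def)
      then have "(?F f, ?F g) \<in> homologous B ?x ?y"
        using eq eq_equiv_class[OF _ eqB] by (simp add: Ho cyc cycH)
      then show "X = Y"
        using fg hom cycH equiv_class_eq[OF eqA] by simp
    qed
    show "Ho_map B F x y ` HoHom A x y = HoHom B ?x ?y"
    proof
      show "Ho_map B F x y ` HoHom A x y \<subseteq> HoHom B ?x ?y"
        using cyc cycH by (fastforce simp: HoHom_def quotient_def Ho)
      show "HoHom B ?x ?y \<subseteq> Ho_map B F x y ` HoHom A x y"
      proof
        fix X assume "X \<in> HoHom B ?x ?y"
        then obtain k where k: "k \<in> cycles B ?x ?y" "X = homologous B ?x ?y `` {k}"
          by (auto simp: HoHom_def quotient_def)
        then obtain f where "f \<in> Hom A x y" "k = ?F f"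
          using bij[OF xy] by (auto simp: bij_betw_def cycles_def)
        with k have "f \<in> cycles A x y" "X = Ho_map B F x y (homologous A x y `` {f})"
          using cyc Ho by auto
        then show "X \<in> Ho_map B F x y ` HoHom A x y"
          by (auto simp: HoHom_def quotient_def)
      qed
    qed
  qed
next
  fix b assume "b \<in> Obj B"
  then show "\<exists>a\<in>Obj A. Ho_isomorphic B (fob F a) b"
    using surj B.Ho_isomorphic_refl by blast
qed


section \<open>Transport of carriers and isomorphism in the localization\<close>

lemma dg_transport_simps:
  assumes "inj a" "inj b"
  shows "Obj (dg_transport a b C) = a ` Obj C"
    and "Hom (dg_transport a b C) (a x) (a y) = b ` Hom C x y"
    and "Zero (dg_transport a b C) (a x) (a y) = b (Zero C x y)"
    and "Add (dg_transport a b C) (a x) (a y) (b f) (b g) = b (Add C x y f g)"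
    and "Scale (dg_transport a b C) (a x) (a y) c (b f) = b (Scale C x y c f)"
    and "Diff (dg_transport a b C) (a x) (a y) (b f) = b (Diff C x y f)"
    and "Idn (dg_transport a b C) (a x) = b (Idn C x)"
    and "Comp (dg_transport a b C) (a x) (a y) (a z) (b g) (b f) = b (Comp C x y z g f)"
  using assms by (simp_all add: dg_transport_def Let_def)

lemma dg_category_transport:
  assumes "dg_category C" "inj a" "inj b"
  shows "dg_category (dg_transport a b C)"
proof -
  interpret dg_category C by fact
  note ts = dg_transport_simps[OF assms(2,3)] inj_image_mem_iff[OF assms(3)]
  show ?thesis
  proof (unfold_locales, goal_cases)
    case (5 x y f g)
    then show ?case by (auto simp: ts intro!: arg_cong[of _ _ b] add_commute)
  next
    case (7 x y f)
    then obtain x' y' f' where *: "x = a x'" "y = a y'" "f = b f'"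
      and **: "x' \<in> Obj C" "y' \<in> Obj C" "f' \<in> Hom C x' y'"
      by (auto simp: ts)
    obtain g where "g \<in> Hom C x' y'" "Add C x' y' f' g = Zero C x' y'"
      using add_inverse[OF **] by blast
    then show ?case
      unfolding * by (intro bexI[of _ "b g"]) (simp_all add: ts)
  qed (auto simp: ts closed add_assoc add_zero scale_one scale_scale scale_add add_scale
      comp_idn idn_comp comp_assoc comp_add_left comp_add_right comp_scale_left
      comp_scale_right diff_add diff_scale diff_diff leibniz)
qed

text \<open>\<open>hqe_isomorphic\<close> compares the two categories inside sum types, so the
  functor has to be conjugated by the injections before it can serve as a step of a zigzag.\<close>

lemma (in dg_functor) quasi_equivalence_transport:
  assumes inj: "inj a1" "inj b1" "inj a2" "inj b2"
    and bij: "\<And>x y. \<lbrakk>x \<in> Obj A; y \<in> Obj A\<rbrakk>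
      \<Longrightarrow> bij_betw (fmo F x y) (Hom A x y) (Hom B (fob F x) (fob F y))"
    and surj: "Obj B \<subseteq> fob F ` Obj A"
  shows "quasi_equivalence (dg_transport a1 b1 A) (dg_transport a2 b2 B)
    \<lparr>fob = (\<lambda>x. a2 (fob F (inv a1 x))),
     fmo = (\<lambda>x y f. b2 (fmo F (inv a1 x) (inv a1 y) (inv b1 f)))\<rparr>" (is "quasi_equivalence ?A ?B ?F")
proof -
  note tA = dg_transport_simps[OF inj(1,2)] and tB = dg_transport_simps[OF inj(3,4)]
  have F: "fob ?F (a1 x) = a2 (fob F x)" "fmo ?F (a1 x) (a1 y) (b1 f) = b2 (fmo F x y f)" for x y f
    using inj by simp_all
  interpret A': dg_category ?A by (rule dg_category_transport[OF A.dg_category_axioms inj(1,2)])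
  interpret B': dg_category ?B by (rule dg_category_transport[OF B.dg_category_axioms inj(3,4)])
  interpret F': dg_functor ?A ?B ?F
    by unfold_locales
      (auto simp: tA tB F fob_closed fmo_closed fmo_add fmo_scale fmo_diff fmo_idn fmo_comp
        simp del: dgfun.simps)
  show ?thesis
  proof (rule F'.quasi_equivalence_if_bij)
    fix X Y assume "X \<in> Obj ?A" "Y \<in> Obj ?A"
    then obtain x y where xy: "X = a1 x" "Y = a1 y" "x \<in> Obj A" "y \<in> Obj A"
      by (auto simp: tA)
    have im: "fmo ?F X Y ` (b1 ` Hom A x y) = b2 ` fmo F x y ` Hom A x y"
      unfolding xy image_image by (intro image_cong refl F)
    have "inj_on (fmo ?F X Y) (b1 ` Hom A x y)"
    proof (rule inj_onI)
      fix f g assume "f \<in> b1 ` Hom A x y" "g \<in> b1 ` Hom A x y" and eq: "fmo ?F X Y f = fmo ?F X Y g"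
      then obtain f' g' where fg: "f = b1 f'" "g = b1 g'" "f' \<in> Hom A x y" "g' \<in> Hom A x y"
        by blast
      with eq have "fmo F x y f' = fmo F x y g'"
        unfolding xy fg F using inj(4) by (simp add: inj_eq)
      with fg show "f = g"
        using bij[OF xy(3,4)] by (auto simp: bij_betw_def inj_on_def)
    qed
    then show "bij_betw (fmo ?F X Y) (Hom ?A X Y) (Hom ?B (fob ?F X) (fob ?F Y))"
      unfolding bij_betw_def xy F tA tB
      using im bij_betw_imp_surj_on[OF bij[OF xy(3,4)]] by (simp only: xy simp_thms)
  next
    show "Obj ?B \<subseteq> fob ?F ` Obj ?A"
    proof
      fix Y assume "Y \<in> Obj ?B"
      then obtain x where "x \<in> Obj A" "Y = a2 (fob F x)" using surj by (auto simp: tB)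
      then show "Y \<in> fob ?F ` Obj ?A"
        unfolding tA by (intro image_eqI[of _ _ "a1 x"]) (simp_all only: F image_eqI)
    qed
  qed
qed

text \<open>The zigzags have length one, and the two required identities are the defining relations
  of the formal inverse.\<close>

lemma hqe_isomorphic_in_if_quasi_equivalence:
  assumes "quasi_equivalence A B w"
  shows "hqe_isomorphic_in A B"
proof -
  interpret quasi_equivalence A B w by fact
  show ?thesis
    unfolding hqe_isomorphic_in_def
  proof (intro exI conjI)
    show "zigzag A [Fwd A w B] B"
      by (intro zz_fwd zz_nil dg_functor_axioms B.dg_category_axioms)
    show "zigzag B [Inv A w B] A"
      by (intro zz_inv zz_nil assms A.dg_category_axioms)
  qed (simp_all add: he_inv_right he_inv_left assms)
qed

lemma (in dg_functor) hqe_isomorphic_if_bij: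
  assumes "\<And>x y. \<lbrakk>x \<in> Obj A; y \<in> Obj A\<rbrakk>
      \<Longrightarrow> bij_betw (fmo F x y) (Hom A x y) (Hom B (fob F x) (fob F y))"
    and "Obj B \<subseteq> fob F ` Obj A"
  shows "A \<cong>\<^sub>H B"
  unfolding hqe_isomorphic_def
  by (rule hqe_isomorphic_in_if_quasi_equivalence, rule quasi_equivalence_transport)
    (simp_all add: assms)


section \<open>The pretriangulated hull\<close>

text \<open>\<open>hom_sum\<close> runs over initial segments only. Sums over arbitrary lists can be
  filtered and reindexed, which is how the summands belonging to a block are selected.\<close>

definition lsum :: "('k, 'o, 'm) dgcat \<Rightarrow> 'o \<Rightarrow> 'o \<Rightarrow> ('i \<Rightarrow> 'm) \<Rightarrow> 'i list \<Rightarrow> 'm" where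
  "lsum C x y f ks = foldr (\<lambda>k. Add C x y (f k)) ks (Zero C x y)"

lemma lsum_simps [simp]:
  "lsum C x y f [] = Zero C x y"
  "lsum C x y f (k # ks) = Add C x y (f k) (lsum C x y f ks)"
  by (simp_all add: lsum_def)

lemma hom_sum_eq_lsum: "hom_sum C x y f n = lsum C x y f [0..<n]"
  by (simp add: hom_sum_def lsum_def)

lemma lsum_map: "lsum C x y f (map g ks) = lsum C x y (\<lambda>k. f (g k)) ks"
  by (induction ks) simp_all

lemma lsum_cong:
  "(\<And>k. k \<in> set ks \<Longrightarrow> f k = g k) \<Longrightarrow> lsum C x y f ks = lsum C x y g ks"
  by (induction ks) simp_all

context dg_category
begin

lemma lsum_closed:
  "\<lbrakk>x \<in> Obj C; y \<in> Obj C; \<And>k. k \<in> set ks \<Longrightarrow> f k \<in> Hom C x y\<rbrakk> \<Longrightarrow> lsum C x y f ks \<in> Hom C x y"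
  by (induction ks) (simp_all add: closed)

lemma lsum_add:
  "\<lbrakk>x \<in> Obj C; y \<in> Obj C; \<And>k. k \<in> set ks \<Longrightarrow> f k \<in> Hom C x y; \<And>k. k \<in> set ks \<Longrightarrow> g k \<in> Hom C x y\<rbrakk>
    \<Longrightarrow> lsum C x y (\<lambda>k. Add C x y (f k) (g k)) ks = Add C x y (lsum C x y f ks) (lsum C x y g ks)"
  by (induction ks) (simp_all add: closed lsum_closed add_zero add_assoc add_left_commute)

lemma lsum_zero:
  "\<lbrakk>x \<in> Obj C; y \<in> Obj C; \<And>k. k \<in> set ks \<Longrightarrow> f k = Zero C x y\<rbrakk> \<Longrightarrow> lsum C x y f ks = Zero C x y"
  by (induction ks) (simp_all add: closed add_zero)

lemma lsum_scale:
  "\<lbrakk>x \<in> Obj C; y \<in> Obj C; \<And>k. k \<in> set ks \<Longrightarrow> f k \<in> Hom C x y\<rbrakk>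
    \<Longrightarrow> lsum C x y (\<lambda>k. Scale C x y c (f k)) ks = Scale C x y c (lsum C x y f ks)"
  by (induction ks) (simp_all add: closed lsum_closed scale_zero scale_add)

lemma lsum_diff:
  "\<lbrakk>x \<in> Obj C; y \<in> Obj C; \<And>k. k \<in> set ks \<Longrightarrow> f k \<in> Hom C x y\<rbrakk>
    \<Longrightarrow> lsum C x y (\<lambda>k. Diff C x y (f k)) ks = Diff C x y (lsum C x y f ks)"
  by (induction ks) (simp_all add: closed lsum_closed diff_zero diff_add)

lemma lsum_comp_right:
  "\<lbrakk>x \<in> Obj C; y \<in> Obj C; z \<in> Obj C; g \<in> Hom C y z; \<And>k. k \<in> set ks \<Longrightarrow> f k \<in> Hom C x y\<rbrakk>
    \<Longrightarrow> lsum C x z (\<lambda>k. Comp C x y z g (f k)) ks = Comp C x y z g (lsum C x y f ks)"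
  by (induction ks) (simp_all add: closed lsum_closed comp_zero_right comp_add_right)

lemma lsum_comp_left:
  "\<lbrakk>x \<in> Obj C; y \<in> Obj C; z \<in> Obj C; f \<in> Hom C x y; \<And>k. k \<in> set ks \<Longrightarrow> g k \<in> Hom C y z\<rbrakk>
    \<Longrightarrow> lsum C x z (\<lambda>k. Comp C x y z (g k) f) ks = Comp C x y z (lsum C y z g ks) f"
  by (induction ks) (simp_all add: closed lsum_closed comp_zero_left comp_add_left)

lemma lsum_swap:
  "\<lbrakk>x \<in> Obj C; y \<in> Obj C; \<And>k l. \<lbrakk>k \<in> set ks; l \<in> set ls\<rbrakk> \<Longrightarrow> f k l \<in> Hom C x y\<rbrakk>
    \<Longrightarrow> lsum C x y (\<lambda>k. lsum C x y (f k) ls) ks = lsum C x y (\<lambda>l. lsum C x y (\<lambda>k. f k l) ks) ls"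
  by (induction ks) (simp_all add: lsum_zero lsum_add lsum_closed)

text \<open>Applied in two ways: \<open>P\<close> singles out one index in products with identity
  matrices, and selects the positions of a block in composites.\<close>

lemma lsum_filter:
  "\<lbrakk>x \<in> Obj C; y \<in> Obj C; \<And>k. k \<in> set ks \<Longrightarrow> f k \<in> Hom C x y;
    \<And>k. \<lbrakk>k \<in> set ks; \<not> P k\<rbrakk> \<Longrightarrow> f k = Zero C x y\<rbrakk>
    \<Longrightarrow> lsum C x y f (filter P ks) = lsum C x y f ks"
  by (induction ks) (simp_all add: closed lsum_closed zero_add)

lemma lsum_single:
  assumes "x \<in> Obj C" "y \<in> Obj C" "i < n" "f i \<in> Hom C x y"
    and "\<And>k. \<lbrakk>k < n; k \<noteq> i\<rbrakk> \<Longrightarrow> f k = Zero C x y"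
  shows "lsum C x y f [0..<n] = f i"
proof -
  have "lsum C x y f [0..<n] = lsum C x y f (filter (\<lambda>k. k = i) [0..<n])"
    using assms by (subst lsum_filter) (auto, metis zero_closed)
  also have "filter (\<lambda>k. k = i) [0..<n] = [i]"
    using \<open>i < n\<close> by (induction n) (auto simp: less_Suc_eq)
  finally show ?thesis
    using assms by (simp add: add_zero)
qed

end


text \<open>The additive hull, that is, twisted complexes with the twist forgotten. Apart from the
  differential, the operations of \<open>pretr C\<close> are those of this category, so most axioms
  can be settled here entry by entry.\<close>

definition mat_cat :: "('k, 'o, 'm) dgcat \<Rightarrow> ('k, 'o list, nat \<Rightarrow> nat \<Rightarrow> 'm) dgcat" where
  "mat_cat C =
    \<lparr>Obj = {xs. set xs \<subseteq> Obj C}, Hom = mat_Hom C, Zero = mat_zero C, Add = mat_add C,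
     Scale = (\<lambda>xs ys c f. mat_of (length xs) (length ys)
       (\<lambda>i j. Scale C (xs ! i) (ys ! j) c (f i j))),
     Diff = mat_diff C,
     Idn = (\<lambda>xs. mat_of (length xs) (length xs)
       (\<lambda>i j. if i = j then Idn C (xs ! i) else Zero C (xs ! i) (xs ! j))),
     Comp = mat_comp C\<rparr>"

text \<open>\<open>mat_Hom\<close> fixes the entries outside the index range to
  \<open>undefined\<close>, so agreement inside the range is equality.\<close>

lemma mat_eqI:
  assumes "f \<in> mat_Hom C xs ys" "g \<in> mat_Hom C xs ys"
    and "\<And>i j. \<lbrakk>i < length xs; j < length ys\<rbrakk> \<Longrightarrow> f i j = g i j"
  shows "f = g"
  using assms unfolding mat_Hom_def by (intro ext) (metis (mono_tags, lifting) mem_Collect_eq)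

lemma mat_of_in_mat_Hom:
  "mat_of (length xs) (length ys) f \<in> mat_Hom C xs ys \<longleftrightarrow>
    (\<forall>i<length xs. \<forall>j<length ys. f i j \<in> Hom C (xs ! i) (ys ! j))"
  by (auto simp: mat_Hom_def mat_of_def)

lemma mat_HomD:
  "\<lbrakk>f \<in> mat_Hom C xs ys; i < length xs; j < length ys\<rbrakk> \<Longrightarrow> f i j \<in> Hom C (xs ! i) (ys ! j)"
  by (auto simp: mat_Hom_def)

lemma mat_entries:
  assumes "i < length xs" "j < length ys"
  shows "mat_zero C xs ys i j = Zero C (xs ! i) (ys ! j)"
    and "mat_add C xs ys f g i j = Add C (xs ! i) (ys ! j) (f i j) (g i j)"
    and "mat_diff C xs ys f i j = Diff C (xs ! i) (ys ! j) (f i j)"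
    and "mat_of (length xs) (length ys) h i j = h i j"
    and "mat_comp C xs zs ys g f i j = lsum C (xs ! i) (ys ! j)
       (\<lambda>k. Comp C (xs ! i) (zs ! k) (ys ! j) (g k j) (f i k)) [0..<length zs]"
  using assms
  by (simp_all add: mat_zero_def mat_add_def mat_diff_def mat_comp_def mat_of_def hom_sum_eq_lsum)

lemma (in dg_category) mat_closed:
  assumes "set xs \<subseteq> Obj C" "set ys \<subseteq> Obj C"
  shows "mat_zero C xs ys \<in> mat_Hom C xs ys"
    and "\<lbrakk>f \<in> mat_Hom C xs ys; g \<in> mat_Hom C xs ys\<rbrakk> \<Longrightarrow> mat_add C xs ys f g \<in> mat_Hom C xs ys"
    and "f \<in> mat_Hom C xs ys \<Longrightarrow> mat_diff C xs ys f \<in> mat_Hom C xs ys"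
    and "f \<in> mat_Hom C xs ys
      \<Longrightarrow> mat_of (length xs) (length ys) (\<lambda>i j. Scale C (xs ! i) (ys ! j) c (f i j)) \<in> mat_Hom C xs ys"
    and "mat_of (length xs) (length xs)
      (\<lambda>i j. if i = j then Idn C (xs ! i) else Zero C (xs ! i) (xs ! j)) \<in> mat_Hom C xs xs"
    and "\<lbrakk>set zs \<subseteq> Obj C; f \<in> mat_Hom C xs ys; g \<in> mat_Hom C ys zs\<rbrakk>
      \<Longrightarrow> mat_comp C xs ys zs g f \<in> mat_Hom C xs zs"
proof -
  have *: "xs ! i \<in> Obj C" "ys ! j \<in> Obj C" if "i < length xs" "j < length ys" for i j
    using that assms nth_mem by blast+
  show "mat_zero C xs ys \<in> mat_Hom C xs ys"
    using * by (simp add: mat_zero_def mat_of_in_mat_Hom closed)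
  show "\<lbrakk>f \<in> mat_Hom C xs ys; g \<in> mat_Hom C xs ys\<rbrakk> \<Longrightarrow> mat_add C xs ys f g \<in> mat_Hom C xs ys"
    using * by (simp add: mat_add_def mat_of_in_mat_Hom closed mat_HomD)
  show "f \<in> mat_Hom C xs ys \<Longrightarrow> mat_diff C xs ys f \<in> mat_Hom C xs ys"
    using * by (simp add: mat_diff_def mat_of_in_mat_Hom closed mat_HomD)
  show "f \<in> mat_Hom C xs ys
      \<Longrightarrow> mat_of (length xs) (length ys) (\<lambda>i j. Scale C (xs ! i) (ys ! j) c (f i j)) \<in> mat_Hom C xs ys"
    using * by (simp add: mat_of_in_mat_Hom closed mat_HomD)
  show "mat_of (length xs) (length xs)
      (\<lambda>i j. if i = j then Idn C (xs ! i) else Zero C (xs ! i) (xs ! j)) \<in> mat_Hom C xs xs"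
    using assms(1) nth_mem by (fastforce simp: mat_of_in_mat_Hom intro: idn_closed zero_closed)
  show "mat_comp C xs ys zs g f \<in> mat_Hom C xs zs"
    if "set zs \<subseteq> Obj C" "f \<in> mat_Hom C xs ys" "g \<in> mat_Hom C ys zs"
  proof -
    have "zs ! i \<in> Obj C" if "i < length zs" for i
      using that \<open>set zs \<subseteq> Obj C\<close> nth_mem by blast
    moreover have "xs ! i \<in> Obj C" if "i < length xs" for i
      using that assms nth_mem by blast
    moreover have "ys ! i \<in> Obj C" if "i < length ys" for i
      using that assms nth_mem by blast
    ultimately show ?thesis using that
      by (auto simp: mat_comp_def mat_of_in_mat_Hom hom_sum_eq_lsum mat_HomD closed intro!: lsum_closed)
  qed
qed

lemma (in dg_category) dg_category_mat_cat: "dg_category (mat_cat C)"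
proof -
  have nth: "xs ! i \<in> Obj C" if "set xs \<subseteq> Obj C" "i < length xs" for xs i
    using that nth_mem by blast
  note ms = mat_entries mat_HomD nth
  show ?thesis
  proof (unfold_locales, simp_all add: mat_cat_def, goal_cases)
    case (1 x y) then show ?case by (simp add: mat_closed)
  next
    case (2 x y f g) then show ?case by (simp add: mat_closed)
  next
    case (3 x y f c) then show ?case by (simp add: mat_closed)
  next
    case (4 x y f g h) then show ?case
      by (intro mat_eqI[of _ C x y]) (simp_all add: mat_closed ms add_assoc)
  next
    case (5 x y f g) then show ?case
      by (intro mat_eqI[of _ C x y]) (simp_all add: mat_closed ms add_commute)
  next
    case (6 x y f) then show ?case
      by (intro mat_eqI[of _ C x y]) (simp_all add: mat_closed ms add_zero)
  next
    case (7 x y f) then show ?case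
      by (intro bexI[of _ "mat_of (length x) (length y) (\<lambda>i j. Scale C (x ! i) (y ! j) (-1) (f i j))"]
          mat_eqI[of _ C x y])
        (simp_all add: mat_closed ms add_minus)
  next
    case (8 x y f) then show ?case
      by (intro mat_eqI[of _ C x y]) (simp_all add: mat_closed ms scale_one)
  next
    case (9 x y f a b) then show ?case
      by (intro mat_eqI[of _ C x y]) (simp_all add: mat_closed ms scale_scale)
  next
    case (10 x y f g a) then show ?case
      by (intro mat_eqI[of _ C x y]) (simp_all add: mat_closed ms scale_add)
  next
    case (11 x y f a b) then show ?case
      by (intro mat_eqI[of _ C x y]) (simp_all add: mat_closed ms add_scale)
  next
    case (12 x) then show ?case by (simp add: mat_closed)
  next
    case (13 x y z f g) then show ?case by (simp add: mat_closed)
  next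
    \<comment> \<open>Only the summand with \<open>k = i\<close> survives, the other entries of the
      identity matrix in row \<open>i\<close> being zero; the next case is its mirror image.\<close>
    case (14 x y f)
    show ?case
    proof (intro mat_eqI[of _ C x y], goal_cases)
      case (3 i j)
      then show ?case using 14
        by (simp add: ms)
          (subst lsum_single[where i=i]; simp add: ms closed comp_idn comp_zero_right)
    qed (use 14 in \<open>simp_all add: mat_closed\<close>)
  next
    case (15 x y f)
    show ?case
    proof (intro mat_eqI[of _ C x y], goal_cases)
      case (3 i j)
      then show ?case using 15
        by (simp add: ms)
          (subst lsum_single[where i=j]; simp add: ms closed idn_comp comp_zero_left)
    qed (use 15 in \<open>simp_all add: mat_closed\<close>)
  next
    \<comment> \<open>Distribute the outer composition over the inner sum, reassociate each term,
      exchange the two sums and collect the terms again.\<close>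
    case (16 w x y z f g h)
    show ?case
    proof (intro mat_eqI[of _ C w z], goal_cases)
      case (3 i j)
      have "lsum C (w ! i) (z ! j) (\<lambda>k. Comp C (w ! i) (x ! k) (z ! j)
            (lsum C (x ! k) (z ! j) (\<lambda>l. Comp C (x ! k) (y ! l) (z ! j) (h l j) (g k l)) [0..<length y])
            (f i k)) [0..<length x] =
          lsum C (w ! i) (z ! j) (\<lambda>k. lsum C (w ! i) (z ! j) (\<lambda>l. Comp C (w ! i) (y ! l) (z ! j) (h l j)
            (Comp C (w ! i) (x ! k) (y ! l) (g k l) (f i k))) [0..<length y]) [0..<length x]"
        using 16 3 by (intro lsum_cong, subst lsum_comp_left[symmetric])
          (auto simp: ms closed intro!: lsum_cong comp_assoc)
      also have "\<dots> = lsum C (w ! i) (z ! j) (\<lambda>l. lsum C (w ! i) (z ! j) (\<lambda>k. Comp C (w ! i) (y ! l) (z ! j) (h l j)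
            (Comp C (w ! i) (x ! k) (y ! l) (g k l) (f i k))) [0..<length x]) [0..<length y]"
        using 16 3 by (intro lsum_swap) (simp_all add: ms closed)
      also have "\<dots> = lsum C (w ! i) (z ! j) (\<lambda>l. Comp C (w ! i) (y ! l) (z ! j) (h l j)
            (lsum C (w ! i) (y ! l) (\<lambda>k. Comp C (w ! i) (x ! k) (y ! l) (g k l) (f i k)) [0..<length x])) [0..<length y]"
        using 16 3 by (intro lsum_cong, subst lsum_comp_right) (simp_all add: ms closed)
      moreover have "mat_comp C w x z (mat_comp C x y z h g) f i j = lsum C (w ! i) (z ! j)
          (\<lambda>k. Comp C (w ! i) (x ! k) (z ! j)
            (lsum C (x ! k) (z ! j) (\<lambda>l. Comp C (x ! k) (y ! l) (z ! j) (h l j) (g k l)) [0..<length y])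
            (f i k)) [0..<length x]"
        using 3 by (subst mat_entries, simp, simp, intro lsum_cong) (simp add: mat_entries)
      moreover have "mat_comp C w y z h (mat_comp C w x y g f) i j = lsum C (w ! i) (z ! j)
          (\<lambda>l. Comp C (w ! i) (y ! l) (z ! j) (h l j)
            (lsum C (w ! i) (y ! l) (\<lambda>k. Comp C (w ! i) (x ! k) (y ! l) (g k l) (f i k)) [0..<length x])) [0..<length y]"
        using 3 by (subst mat_entries, simp, simp, intro lsum_cong) (simp add: mat_entries)
      ultimately show ?case by simp
    qed (use 16 in \<open>simp_all add: mat_closed\<close>)
  next
    case (17 x y z f f' g)
    show ?case
    proof (intro mat_eqI[of _ C x z], goal_cases)
      case (3 i j)
      then show ?case using 17
        by (simp add: ms mat_closed, subst lsum_add[symmetric])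
          (auto simp: ms closed comp_add_right intro!: lsum_cong)
    qed (use 17 in \<open>simp_all add: mat_closed\<close>)
  next
    case (18 x y z f g g')
    show ?case
    proof (intro mat_eqI[of _ C x z], goal_cases)
      case (3 i j)
      then show ?case using 18
        by (simp add: ms mat_closed, subst lsum_add[symmetric])
          (auto simp: ms closed comp_add_left intro!: lsum_cong)
    qed (use 18 in \<open>simp_all add: mat_closed\<close>)
  next
    case (19 x y z f g c)
    show ?case
    proof (intro mat_eqI[of _ C x z], goal_cases)
      case (3 i j)
      then show ?case using 19
        by (simp add: ms mat_closed, subst lsum_scale[symmetric])
          (auto simp: ms closed comp_scale_right intro!: lsum_cong)
    qed (use 19 in \<open>simp_all add: mat_closed\<close>)
  next
    case (20 x y z f g c)
    show ?case
    proof (intro mat_eqI[of _ C x z], goal_cases)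
      case (3 i j)
      then show ?case using 20
        by (simp add: ms mat_closed, subst lsum_scale[symmetric])
          (auto simp: ms closed comp_scale_left intro!: lsum_cong)
    qed (use 20 in \<open>simp_all add: mat_closed\<close>)
  next
    case (21 x y f) then show ?case by (simp add: mat_closed)
  next
    case (22 x y f g) then show ?case
      by (intro mat_eqI[of _ C x y]) (simp_all add: mat_closed ms diff_add)
  next
    case (23 x y f c) then show ?case
      by (intro mat_eqI[of _ C x y]) (simp_all add: mat_closed ms diff_scale)
  next
    case (24 x y f) then show ?case
      by (intro mat_eqI[of _ C x y]) (simp_all add: mat_closed ms diff_diff)
  next
    case (25 x y z f g)
    show ?case
    proof (intro mat_eqI[of _ C x z], goal_cases)
      case (3 i j)
      then show ?case using 25
        by (simp add: ms mat_closed, subst lsum_diff[symmetric], simp_all add: ms closed,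
            subst lsum_add[symmetric])
          (auto simp: ms closed leibniz intro!: lsum_cong)
    qed (use 25 in \<open>simp_all add: mat_closed\<close>)
  qed
qed


section \<open>The twisted differential\<close>

lemma pretr_simps:
  "Obj (pretr C) = {(xs, p). xs \<in> Obj (mat_cat C) \<and> p \<in> Hom (mat_cat C) xs xs \<and>
     (\<forall>i<length xs. \<forall>j\<le>i. p i j = Zero C (xs ! i) (xs ! j)) \<and>
     Add (mat_cat C) xs xs (Diff (mat_cat C) xs xs p) (Comp (mat_cat C) xs xs xs p p) =
       Zero (mat_cat C) xs xs}"
  "Hom (pretr C) X Y = Hom (mat_cat C) (fst X) (fst Y)"
  "Zero (pretr C) X Y = Zero (mat_cat C) (fst X) (fst Y)"
  "Add (pretr C) X Y = Add (mat_cat C) (fst X) (fst Y)"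
  "Scale (pretr C) X Y = Scale (mat_cat C) (fst X) (fst Y)"
  "Diff (pretr C) X Y f = Add (mat_cat C) (fst X) (fst Y) (Diff (mat_cat C) (fst X) (fst Y) f)
     (Add (mat_cat C) (fst X) (fst Y) (Comp (mat_cat C) (fst X) (fst Y) (fst Y) (snd Y) f)
        (Comp (mat_cat C) (fst X) (fst X) (fst Y) f (snd X)))"
  "Idn (pretr C) X = Idn (mat_cat C) (fst X)"
  "Comp (pretr C) X Y Z = Comp (mat_cat C) (fst X) (fst Y) (fst Z)"
  by (auto simp: pretr_def mat_cat_def split_beta)

lemma (in dg_category_char2) dg_category_pretr: "dg_category (pretr C)"
proof -
  let ?M = "mat_cat C"
  interpret M: dg_category_char2 ?M
    by (rule dg_category_char2.intro[OF dg_category_mat_cat]) (unfold_locales, rule char2)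
  have ob: "fst X \<in> Obj ?M" "snd X \<in> Hom ?M (fst X) (fst X)" if "X \<in> Obj (pretr C)" for X
    using that by (auto simp: pretr_simps)
  \<comment> \<open>In characteristic 2 the Maurer-Cartan equation \<open>dp + pp = 0\<close>
    becomes \<open>dp = pp\<close>, which can be used as a rewrite rule.\<close>
  have mc: "Diff ?M (fst X) (fst X) (snd X) = Comp ?M (fst X) (fst X) (fst X) (snd X) (snd X)"
    if "X \<in> Obj (pretr C)" for X
  proof -
    have *: "Add ?M (fst X) (fst X) (Comp ?M (fst X) (fst X) (fst X) (snd X) (snd X))
        (Diff ?M (fst X) (fst X) (snd X)) =
      Add ?M (fst X) (fst X) (Comp ?M (fst X) (fst X) (fst X) (snd X) (snd X))
        (Comp ?M (fst X) (fst X) (fst X) (snd X) (snd X))"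
      using that by (auto simp: pretr_simps M.add_self M.closed M.add_commute)
    then show ?thesis
      using ob[OF that] by (intro M.add_left_cancel[OF _ _ _ _ _ *]) (simp_all add: M.closed)
  qed
  \<comment> \<open>After sorting sums with \<open>ac\<close>, equal summands are adjacent; this
    rule cancels such a pair in front of the rest of a sum.\<close>
  have self': "Add ?M x y f (Add ?M x y f g) = g"
    if "x \<in> Obj ?M" "y \<in> Obj ?M" "f \<in> Hom ?M x y" "g \<in> Hom ?M x y" for x y f g
    using that by (simp add: M.add_self M.zero_add M.closed flip: M.add_assoc)
  note ac = M.add_assoc M.add_commute M.add_left_commute
  note cmp = M.comp_add_left M.comp_add_right M.comp_assoc
  show ?thesis
  proof (unfold_locales, simp_all only: pretr_simps(2-), goal_cases)
    case (7 x y f) then show ?case using M.add_inverse ob by blast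
  next
    case (16 w x y z f g h) then show ?case using M.comp_assoc ob by blast
  next
    \<comment> \<open>With twists \<open>p\<close> and \<open>q\<close> of source and target, the
      square expands to pairs of \<open>q df\<close>, \<open>df p\<close> and \<open>q f p\<close>,
      together with \<open>dq f + qq f\<close> and \<open>f dp + f pp\<close>, which cancel by
      \<open>mc\<close>.\<close>
    case (24 x y f)
    then show ?case
      using ob[OF 24(1)] ob[OF 24(2)]
      by (simp add: M.closed M.diff_add M.leibniz mc M.diff_diff cmp ac M.add_self self' M.zero_add
          M.add_zero)
  next
    \<comment> \<open>The right-hand side has two additional terms \<open>g q f\<close>, where
      \<open>q\<close> is the twist of the middle object; they cancel each other.\<close>
    case (25 x y z f g)
    then show ?case
      using ob[OF 25(1)] ob[OF 25(2)] ob[OF 25(3)]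
      by (simp add: M.closed M.leibniz cmp ac M.add_self self' M.zero_add M.add_zero)
  qed (simp_all add: ob M.closed M.add_assoc M.add_zero M.scale_one M.scale_scale M.scale_add
      M.add_scale M.comp_idn M.idn_comp M.comp_add_left M.comp_add_right M.comp_scale_left
      M.comp_scale_right M.diff_add M.diff_scale M.add_commute M.add_left_commute)
qed

section \<open>Full subcategories and products\<close>

lemma (in dg_category) dg_category_full_subcat: "dg_category (full_subcat C X)"
  by (unfold_locales; simp add: full_subcat_def closed add_assoc add_zero scale_one scale_scale
      scale_add add_scale comp_idn idn_comp comp_assoc comp_add_left comp_add_right
      comp_scale_left comp_scale_right diff_add diff_scale diff_diff leibniz add_inverse)
    (metis add_commute)

lemma dg_category_product:
  assumes "dg_category A" "dg_category B"
  shows "dg_category (A \<times>\<^sub>D B)"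
proof -
  interpret A: dg_category A by fact
  interpret B: dg_category B by fact
  show ?thesis
  proof (unfold_locales, goal_cases)
    case (7 x y f)
    then show ?case
      using A.add_inverse[of "fst x" "fst y" "fst f"] B.add_inverse[of "snd x" "snd y" "snd f"]
      by (auto simp: dg_product_def)
  qed (auto simp: dg_product_def A.closed B.closed A.add_assoc B.add_assoc A.add_zero B.add_zero
      A.scale_one B.scale_one A.scale_scale B.scale_scale A.scale_add B.scale_add
      A.add_scale B.add_scale A.comp_idn B.comp_idn A.idn_comp B.idn_comp A.comp_assoc B.comp_assoc
      A.comp_add_left B.comp_add_left A.comp_add_right B.comp_add_right
      A.comp_scale_left B.comp_scale_left A.comp_scale_right B.comp_scale_right
      A.diff_add B.diff_add A.diff_scale B.diff_scale A.diff_diff B.diff_diff A.leibniz B.leibniz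
      intro: A.add_commute B.add_commute)
qed

lemma dg_functor_pair:
  assumes "dg_functor A B F" "dg_functor A C G"
  shows "dg_functor A (B \<times>\<^sub>D C)
    \<lparr>fob = (\<lambda>x. (fob F x, fob G x)), fmo = (\<lambda>x y f. (fmo F x y f, fmo G x y f))\<rparr>"
proof -
  interpret F: dg_functor A B F by fact
  interpret G: dg_functor A C G by fact
  interpret dg_category "B \<times>\<^sub>D C"
    by (rule dg_category_product) unfold_locales
  show ?thesis
    by unfold_locales
      (auto simp: dg_product_def F.fob_closed G.fob_closed F.fmo_closed G.fmo_closed F.fmo_add
        G.fmo_add F.fmo_scale G.fmo_scale F.fmo_diff G.fmo_diff F.fmo_idn G.fmo_idn F.fmo_comp
        G.fmo_comp)
qed


section \<open>Splitting along orthogonal blocks of objects\<close>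

text \<open>Orthogonality is required in both directions, so the complement is again a block and
  results for \<open>A\<close> apply to \<open>Obj C - A\<close>.\<close>

definition (in dg_category) block :: "'o set \<Rightarrow> bool" where
  "block A \<longleftrightarrow> A \<subseteq> Obj C \<and>
    (\<forall>x\<in>A. \<forall>y\<in>Obj C - A. Hom C x y = {Zero C x y} \<and> Hom C y x = {Zero C y x})"

text \<open>Positions are recorded instead of objects because one object may occur several times in
  a twisted complex.\<close>

definition block_idx :: "'o set \<Rightarrow> 'o list \<Rightarrow> nat list" where
  "block_idx A xs = filter (\<lambda>i. xs ! i \<in> A) [0..<length xs]"

definition mat_restrict ::
  "'o set \<Rightarrow> 'o list \<Rightarrow> 'o list \<Rightarrow> (nat \<Rightarrow> nat \<Rightarrow> 'm) \<Rightarrow> nat \<Rightarrow> nat \<Rightarrow> 'm" where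
  "mat_restrict A xs ys f = mat_of (length (block_idx A xs)) (length (block_idx A ys))
     (\<lambda>i j. f (block_idx A xs ! i) (block_idx A ys ! j))"

definition restrict_functor ::
  "'o set \<Rightarrow> (('o, 'm) twisted, nat \<Rightarrow> nat \<Rightarrow> 'm, ('o, 'm) twisted, nat \<Rightarrow> nat \<Rightarrow> 'm) dgfun" where
  "restrict_functor A =
    \<lparr>fob = (\<lambda>(xs, p). (filter (\<lambda>x. x \<in> A) xs, mat_restrict A xs xs p)),
     fmo = (\<lambda>(xs, p) (ys, q). mat_restrict A xs ys)\<rparr>"

lemma map_block_idx: "map ((!) xs) (block_idx A xs) = filter (\<lambda>x. x \<in> A) xs"
proof -
  have "filter (\<lambda>x. x \<in> A) xs = filter (\<lambda>x. x \<in> A) (map ((!) xs) [0..<length xs])"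
    by (simp add: map_nth)
  then show ?thesis
    by (simp add: filter_map block_idx_def o_def)
qed

lemma length_block_idx: "length (block_idx A xs) = length (filter (\<lambda>x. x \<in> A) xs)"
  by (metis length_map map_block_idx)

lemma nth_filter_block_idx:
  "i < length (filter (\<lambda>x. x \<in> A) xs) \<Longrightarrow> filter (\<lambda>x. x \<in> A) xs ! i = xs ! (block_idx A xs ! i)"
  by (metis length_block_idx map_block_idx nth_map)

lemma set_block_idx: "set (block_idx A xs) = {i. i < length xs \<and> xs ! i \<in> A}"
  by (auto simp: block_idx_def)

lemma block_idx_nth:
  assumes "i < length (filter (\<lambda>x. x \<in> A) xs)"
  shows "block_idx A xs ! i < length xs" and "xs ! (block_idx A xs ! i) \<in> A"
  using nth_mem[of i "block_idx A xs"] assms by (auto simp: set_block_idx length_block_idx)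

lemma inj_on_block_idx: "inj_on ((!) (block_idx A xs)) {..<length (filter (\<lambda>x. x \<in> A) xs)}"
  by (intro inj_on_nth) (auto simp: block_idx_def length_block_idx[symmetric])

text \<open>The positions of a block are listed increasingly. This transfers one-sidedness, a
  condition on index pairs with \<open>j \<le> i\<close>, between a complex and its blocks.\<close>

lemma block_idx_le_iff:
  assumes "i < length (filter (\<lambda>x. x \<in> A) xs)" "j < length (filter (\<lambda>x. x \<in> A) xs)"
  shows "block_idx A xs ! j \<le> block_idx A xs ! i \<longleftrightarrow> j \<le> i"
proof -
  have "sorted_wrt (<) (block_idx A xs)"
    unfolding block_idx_def by (intro sorted_wrt_filter) simp
  then have "block_idx A xs ! k < block_idx A xs ! l"
    if "k < l" "l < length (filter (\<lambda>x. x \<in> A) xs)" for k l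
    using that by (simp add: sorted_wrt_iff_nth_less length_block_idx)
  then show ?thesis
    using assms by (metis leD le_eq_less_or_eq nat_le_linear)
qed

lemma mat_restrict_entry:
  assumes "i < length (filter (\<lambda>x. x \<in> A) xs)" "j < length (filter (\<lambda>x. x \<in> A) ys)"
  shows "mat_restrict A xs ys f i j = f (block_idx A xs ! i) (block_idx A ys ! j)"
  using assms by (simp add: mat_restrict_def mat_of_def length_block_idx)

lemma mat_restrict_closed:
  "f \<in> mat_Hom C xs ys
    \<Longrightarrow> mat_restrict A xs ys f \<in> mat_Hom C (filter (\<lambda>x. x \<in> A) xs) (filter (\<lambda>x. x \<in> A) ys)"
  unfolding mat_restrict_def length_block_idx mat_of_in_mat_Hom
  by (auto simp: nth_filter_block_idx intro: mat_HomD block_idx_nth)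

context dg_category
begin

lemma mat_restrict_add:
  assumes "set xs \<subseteq> Obj C" "set ys \<subseteq> Obj C" "f \<in> mat_Hom C xs ys" "g \<in> mat_Hom C xs ys"
  shows "mat_restrict A xs ys (mat_add C xs ys f g) =
    mat_add C (filter (\<lambda>x. x \<in> A) xs) (filter (\<lambda>x. x \<in> A) ys)
      (mat_restrict A xs ys f) (mat_restrict A xs ys g)"
  by (rule mat_eqI[of _ C "filter (\<lambda>x. x \<in> A) xs" "filter (\<lambda>x. x \<in> A) ys"])
    (use assms in \<open>auto simp: mat_restrict_entry mat_entries block_idx_nth nth_filter_block_idx
      intro!: mat_restrict_closed mat_closed\<close>)

lemma mat_restrict_diff:
  assumes "set xs \<subseteq> Obj C" "set ys \<subseteq> Obj C" "f \<in> mat_Hom C xs ys"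
  shows "mat_restrict A xs ys (mat_diff C xs ys f) =
    mat_diff C (filter (\<lambda>x. x \<in> A) xs) (filter (\<lambda>x. x \<in> A) ys) (mat_restrict A xs ys f)"
  by (rule mat_eqI[of _ C "filter (\<lambda>x. x \<in> A) xs" "filter (\<lambda>x. x \<in> A) ys"])
    (use assms in \<open>auto simp: mat_restrict_entry mat_entries block_idx_nth nth_filter_block_idx
      intro!: mat_restrict_closed mat_closed\<close>)

lemma mat_restrict_zero:
  assumes "set xs \<subseteq> Obj C" "set ys \<subseteq> Obj C"
  shows "mat_restrict A xs ys (mat_zero C xs ys) =
    mat_zero C (filter (\<lambda>x. x \<in> A) xs) (filter (\<lambda>x. x \<in> A) ys)"
  by (rule mat_eqI[of _ C "filter (\<lambda>x. x \<in> A) xs" "filter (\<lambda>x. x \<in> A) ys"])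
    (use assms in \<open>auto simp: mat_restrict_entry mat_entries block_idx_nth nth_filter_block_idx
      intro!: mat_restrict_closed mat_closed\<close>)

lemma mat_restrict_scale:
  assumes "set xs \<subseteq> Obj C" "set ys \<subseteq> Obj C" "f \<in> mat_Hom C xs ys"
  shows "mat_restrict A xs ys (Scale (mat_cat C) xs ys c f) =
    Scale (mat_cat C) (filter (\<lambda>x. x \<in> A) xs) (filter (\<lambda>x. x \<in> A) ys) c (mat_restrict A xs ys f)"
  by (rule mat_eqI[of _ C "filter (\<lambda>x. x \<in> A) xs" "filter (\<lambda>x. x \<in> A) ys"])
    (use assms in \<open>auto simp: mat_cat_def mat_restrict_entry mat_entries block_idx_nth
      nth_filter_block_idx intro!: mat_restrict_closed mat_closed\<close>)

lemma mat_restrict_idn: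
  assumes "set xs \<subseteq> Obj C"
  shows "mat_restrict A xs xs (Idn (mat_cat C) xs) = Idn (mat_cat C) (filter (\<lambda>x. x \<in> A) xs)"
proof (rule mat_eqI[of _ C "filter (\<lambda>x. x \<in> A) xs" "filter (\<lambda>x. x \<in> A) xs"])
  fix i j assume ij: "i < length (filter (\<lambda>x. x \<in> A) xs)" "j < length (filter (\<lambda>x. x \<in> A) xs)"
  \<comment> \<open>Positions in a block are distinct, so the diagonal of the restriction comes
    exactly from the diagonal of the full matrix.\<close>
  then have "block_idx A xs ! i = block_idx A xs ! j \<longleftrightarrow> i = j"
    using inj_on_block_idx[of A xs] by (auto simp: inj_on_def)
  with ij show "mat_restrict A xs xs (Idn (mat_cat C) xs) i j =
      Idn (mat_cat C) (filter (\<lambda>x. x \<in> A) xs) i j"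
    by (simp add: mat_cat_def mat_restrict_entry mat_entries block_idx_nth nth_filter_block_idx)
qed (use assms in \<open>auto simp: mat_cat_def intro!: mat_restrict_closed mat_closed\<close>)

text \<open>A path from the block to itself through an object outside of it is a composite of zeros.\<close>

lemma mat_restrict_comp:
  assumes A: "block A" and xs: "set xs \<subseteq> Obj C" and ys: "set ys \<subseteq> Obj C" and zs: "set zs \<subseteq> Obj C"
    and f: "f \<in> mat_Hom C xs ys" and g: "g \<in> mat_Hom C ys zs"
  shows "mat_restrict A xs zs (mat_comp C xs ys zs g f) =
    mat_comp C (filter (\<lambda>x. x \<in> A) xs) (filter (\<lambda>x. x \<in> A) ys) (filter (\<lambda>x. x \<in> A) zs)
      (mat_restrict A ys zs g) (mat_restrict A xs ys f)"
proof (rule mat_eqI[of _ C "filter (\<lambda>x. x \<in> A) xs" "filter (\<lambda>x. x \<in> A) zs"])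
  fix i j assume ij: "i < length (filter (\<lambda>x. x \<in> A) xs)" "j < length (filter (\<lambda>x. x \<in> A) zs)"
  let ?i = "block_idx A xs ! i" and ?j = "block_idx A zs ! j"
  note idx = block_idx_nth[OF ij(1)] block_idx_nth[OF ij(2)]
  have ob: "xs ! ?i \<in> Obj C" "zs ! ?j \<in> Obj C"
    using idx xs zs by (meson nth_mem subsetD)+
  have oby: "ys ! k \<in> Obj C" if "k < length ys" for k
    using that ys by (meson nth_mem subsetD)
  let ?c = "\<lambda>k. Comp C (xs ! ?i) (ys ! k) (zs ! ?j) (g k ?j) (f ?i k)"
  have c: "?c k \<in> Hom C (xs ! ?i) (zs ! ?j)" if "k < length ys" for k
    using that idx ob oby f g by (simp add: closed mat_HomD)
  have cz: "?c k = Zero C (xs ! ?i) (zs ! ?j)" if k: "k < length ys" "ys ! k \<notin> A" for k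
  proof -
    have "f ?i k = Zero C (xs ! ?i) (ys ! k)"
      using A idx oby[OF k(1)] k mat_HomD[OF f idx(1) k(1)] by (auto simp: block_def)
    then show ?thesis
      using k ob oby idx g by (simp add: comp_zero_right mat_HomD)
  qed
  have "mat_restrict A xs zs (mat_comp C xs ys zs g f) i j =
      lsum C (xs ! ?i) (zs ! ?j) ?c [0..<length ys]"
    using ij idx by (simp add: mat_restrict_entry mat_entries)
  also have "\<dots> = lsum C (xs ! ?i) (zs ! ?j) ?c (block_idx A ys)"
    unfolding block_idx_def[of A ys] using ob c cz by (intro lsum_filter[symmetric]) auto
  \<comment> \<open>Reindexing by the rank inside the block turns the sum over surviving positions
    into the one defining the composite of the restrictions.\<close>
  also have "block_idx A ys = map ((!) (block_idx A ys)) [0..<length (filter (\<lambda>x. x \<in> A) ys)]"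
    by (simp add: map_nth flip: length_block_idx)
  also have "lsum C (xs ! ?i) (zs ! ?j) ?c \<dots> =
      mat_comp C (filter (\<lambda>x. x \<in> A) xs) (filter (\<lambda>x. x \<in> A) ys) (filter (\<lambda>x. x \<in> A) zs)
        (mat_restrict A ys zs g) (mat_restrict A xs ys f) i j"
    unfolding lsum_map mat_entries(5)[OF ij] nth_filter_block_idx[OF ij(1)] nth_filter_block_idx[OF ij(2)]
    using ij by (intro lsum_cong) (simp add: mat_restrict_entry nth_filter_block_idx)
  finally show "mat_restrict A xs zs (mat_comp C xs ys zs g f) i j = \<dots>" .
qed (use assms in \<open>auto intro!: mat_restrict_closed mat_closed\<close>)

end

text \<open>Restriction commutes with sums, differentials and, because \<open>A\<close> is a block,
  with composites. The Maurer-Cartan equation and the twisted differential are built from these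
  operations and hence are preserved.\<close>

lemma (in dg_category_char2) dg_functor_restrict:
  assumes A: "block A"
  shows "dg_functor (pretr C) (full_subcat (pretr C) {(xs, p). set xs \<subseteq> A}) (restrict_functor A)"
proof -
  interpret P: dg_category "pretr C" by (rule dg_category_pretr)
  interpret Q: dg_category "full_subcat (pretr C) {(xs, p). set xs \<subseteq> A}"
    by (rule P.dg_category_full_subcat)
  note rs = mat_restrict_add mat_restrict_diff mat_restrict_zero mat_restrict_comp[OF A] mat_closed
  note unf = restrict_functor_def full_subcat_def pretr_simps
  show ?thesis
  proof (unfold_locales, goal_cases)
    case (1 X)
    obtain xs p where X: "X = (xs, p)" by (cases X)
    let ?xs = "filter (\<lambda>x. x \<in> A) xs" and ?p = "mat_restrict A xs xs p"
    have xs: "set xs \<subseteq> Obj C" and p: "p \<in> mat_Hom C xs xs"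
      and one: "\<And>i j. \<lbrakk>i < length xs; j \<le> i\<rbrakk> \<Longrightarrow> p i j = Zero C (xs ! i) (xs ! j)"
      and mc: "mat_add C xs xs (mat_diff C xs xs p) (mat_comp C xs xs xs p p) = mat_zero C xs xs"
      using 1 by (auto simp: X pretr_def)
    have "?p i j = Zero C (?xs ! i) (?xs ! j)" if "i < length ?xs" "j \<le> i" for i j
      using that one[of "block_idx A xs ! i" "block_idx A xs ! j"]
      by (simp add: mat_restrict_entry block_idx_le_iff block_idx_nth nth_filter_block_idx)
    moreover have "mat_add C ?xs ?xs (mat_diff C ?xs ?xs ?p) (mat_comp C ?xs ?xs ?xs ?p ?p) =
        mat_zero C ?xs ?xs"
      using arg_cong[OF mc, of "mat_restrict A xs xs"] xs p by (simp add: rs)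
    ultimately show ?case
      using xs p by (auto simp: X restrict_functor_def full_subcat_def pretr_def
          intro: mat_restrict_closed)
  next
    case (2 X Y f)
    then show ?case
      by (auto simp: unf mat_cat_def split_beta intro: mat_restrict_closed)
  next
    case (3 X Y f g)
    then show ?case by (auto simp: unf mat_cat_def split_beta rs)
  next
    case (4 X Y f c)
    then show ?case
      using mat_restrict_scale[of "fst X" "fst Y" f A c] by (auto simp: unf mat_cat_def split_beta)
  next
    case (5 X Y f)
    then show ?case by (auto simp: unf mat_cat_def split_beta rs)
  next
    case (6 X)
    then show ?case
      using mat_restrict_idn[of "fst X" A] by (auto simp: unf mat_cat_def split_beta)
  next
    case (7 X Y Z f g)
    then show ?case by (auto simp: unf mat_cat_def split_beta rs)
  qed
qed


section \<open>Reconstruction from the two blocks\<close>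

lemma block_idx_obtain:
  assumes "i < length xs" "xs ! i \<in> A"
  obtains k where "k < length (filter (\<lambda>x. x \<in> A) xs)" "i = block_idx A xs ! k"
  using assms set_block_idx[of A xs] by (metis (mono_tags) in_set_conv_nth length_block_idx mem_Collect_eq)

context dg_category
begin

lemma block_compl: "block A \<Longrightarrow> block (Obj C - A)"
  by (auto simp: block_def)

lemma block_cross:
  "\<lbrakk>block A; x \<in> Obj C; y \<in> Obj C; x \<in> A \<longleftrightarrow> y \<notin> A; f \<in> Hom C x y\<rbrakk> \<Longrightarrow> f = Zero C x y"
  unfolding block_def by blast

text \<open>An entry inside a block is visible in the restriction to it, and an entry between the
  blocks is zero in both matrices.\<close>

lemma mat_restrict_inj:
  assumes A: "block A" and xs: "set xs \<subseteq> Obj C" and ys: "set ys \<subseteq> Obj C"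
    and f: "f \<in> mat_Hom C xs ys" and g: "g \<in> mat_Hom C xs ys"
    and eq: "mat_restrict A xs ys f = mat_restrict A xs ys g"
      "mat_restrict (Obj C - A) xs ys f = mat_restrict (Obj C - A) xs ys g"
  shows "f = g"
proof (rule mat_eqI[OF f g])
  fix i j assume ij: "i < length xs" "j < length ys"
  have ob: "xs ! i \<in> Obj C" "ys ! j \<in> Obj C"
    using ij xs ys by (meson nth_mem subsetD)+
  have same: "f i j = g i j"
    if D: "xs ! i \<in> D" "ys ! j \<in> D" "mat_restrict D xs ys f = mat_restrict D xs ys g" for D
  proof -
    obtain k where k: "k < length (filter (\<lambda>x. x \<in> D) xs)" "i = block_idx D xs ! k"
      by (rule block_idx_obtain[OF ij(1) D(1)])
    obtain l where l: "l < length (filter (\<lambda>x. x \<in> D) ys)" "j = block_idx D ys ! l"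
      by (rule block_idx_obtain[OF ij(2) D(2)])
    have "f i j = mat_restrict D xs ys f k l"
      using k l by (simp add: mat_restrict_entry)
    also have "\<dots> = g i j"
      unfolding D(3) using k l by (simp add: mat_restrict_entry)
    finally show ?thesis .
  qed
  show "f i j = g i j"
  proof (cases "xs ! i \<in> A \<longleftrightarrow> ys ! j \<in> A")
    case True
    then show ?thesis using same[of A] same[of "Obj C - A"] eq ob by blast
  next
    case False
    then show ?thesis
      using block_cross[OF A ob] mat_HomD[OF f ij] mat_HomD[OF g ij] by metis
  qed
qed

text \<open>The witness is the block diagonal matrix; \<open>pos\<close> translates a position in
  the full list back to its index in a block. Disjointness keeps the first branch of the conditional
  from overriding \<open>q\<close>.\<close>

lemma mat_restrict_surj:
  assumes xs: "set xs \<subseteq> Obj C" and ys: "set ys \<subseteq> Obj C"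
    and p: "p \<in> mat_Hom C (filter (\<lambda>x. x \<in> A) xs) (filter (\<lambda>x. x \<in> A) ys)"
    and q: "q \<in> mat_Hom C (filter (\<lambda>x. x \<in> B) xs) (filter (\<lambda>x. x \<in> B) ys)"
    and AB: "A \<inter> B = {}"
  obtains f where "f \<in> mat_Hom C xs ys" "mat_restrict A xs ys f = p" "mat_restrict B xs ys f = q"
proof -
  define pos where
    "pos D zs = inv_into {..<length (filter (\<lambda>x. x \<in> D) zs)} ((!) (block_idx D zs))"
    for D :: "'o set" and zs
  have pos: "pos D zs (block_idx D zs ! k) = k"
    if "k < length (filter (\<lambda>x. x \<in> D) zs)" for D :: "'o set" and zs k
    unfolding pos_def using that by (intro inv_into_f_f inj_on_block_idx) simp
  define f where "f = mat_of (length xs) (length ys)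
    (\<lambda>i j. if xs ! i \<in> A \<and> ys ! j \<in> A then p (pos A xs i) (pos A ys j)
      else if xs ! i \<in> B \<and> ys ! j \<in> B then q (pos B xs i) (pos B ys j)
      else Zero C (xs ! i) (ys ! j))"
  have in_Hom: "r (pos D xs i) (pos D ys j) \<in> Hom C (xs ! i) (ys ! j)"
    if r: "r \<in> mat_Hom C (filter (\<lambda>x. x \<in> D) xs) (filter (\<lambda>x. x \<in> D) ys)"
      "i < length xs" "j < length ys" "xs ! i \<in> D" "ys ! j \<in> D" for r D i j
  proof -
    obtain k where k: "k < length (filter (\<lambda>x. x \<in> D) xs)" "i = block_idx D xs ! k"
      by (rule block_idx_obtain[OF r(2,4)])
    obtain l where l: "l < length (filter (\<lambda>x. x \<in> D) ys)" "j = block_idx D ys ! l"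
      by (rule block_idx_obtain[OF r(3,5)])
    show ?thesis
      using mat_HomD[OF r(1) k(1) l(1)] k l by (simp add: pos nth_filter_block_idx)
  qed
  have f: "f \<in> mat_Hom C xs ys"
    unfolding f_def mat_of_in_mat_Hom
    using xs ys p q nth_mem by (fastforce intro: in_Hom zero_closed)
  moreover have "mat_restrict A xs ys f = p"
    by (rule mat_eqI[OF mat_restrict_closed[OF f] p])
      (simp add: f_def mat_restrict_entry mat_entries block_idx_nth pos)
  moreover have "mat_restrict B xs ys f = q"
    by (rule mat_eqI[OF mat_restrict_closed[OF f] q])
      (use AB block_idx_nth(2) in \<open>fastforce simp: f_def mat_restrict_entry mat_entries block_idx_nth pos\<close>)
  ultimately show ?thesis by (rule that)
qed

end

text \<open>The preimage is the direct sum on the list \<open>us @ vs\<close>. Filtering this list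
  returns \<open>us\<close> and \<open>vs\<close> literally, so objects are hit exactly and not just
  up to homotopy.\<close>

lemma (in dg_category_char2) pretr_amalgamate:
  assumes A: "block A"
    and X: "(us, p) \<in> Obj (pretr C)" "set us \<subseteq> A" and Y: "(vs, q) \<in> Obj (pretr C)" "set vs \<subseteq> Obj C - A"
  obtains Z where "Z \<in> Obj (pretr C)" "fob (restrict_functor A) Z = (us, p)"
    "fob (restrict_functor (Obj C - A)) Z = (vs, q)"
proof -
  let ?B = "Obj C - A" and ?zs = "us @ vs"
  have fA: "filter (\<lambda>x. x \<in> A) ?zs = us" and fB: "filter (\<lambda>x. x \<in> ?B) ?zs = vs"
  proof -
    have "filter (\<lambda>x. x \<in> A) us = us" "filter (\<lambda>x. x \<in> A) vs = []"
      "filter (\<lambda>x. x \<in> ?B) us = []" "filter (\<lambda>x. x \<in> ?B) vs = vs"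
      using X(2) Y(2) by (auto simp: filter_id_conv filter_empty_conv)
    then show "filter (\<lambda>x. x \<in> A) ?zs = us" "filter (\<lambda>x. x \<in> ?B) ?zs = vs"
      by (simp_all only: filter_append append_Nil append_Nil2)
  qed
  have p: "p \<in> mat_Hom C us us" "\<And>i j. \<lbrakk>i < length us; j \<le> i\<rbrakk> \<Longrightarrow> p i j = Zero C (us ! i) (us ! j)"
      "mat_add C us us (mat_diff C us us p) (mat_comp C us us us p p) = mat_zero C us us"
    and q: "q \<in> mat_Hom C vs vs" "\<And>i j. \<lbrakk>i < length vs; j \<le> i\<rbrakk> \<Longrightarrow> q i j = Zero C (vs ! i) (vs ! j)"
      "mat_add C vs vs (mat_diff C vs vs q) (mat_comp C vs vs vs q q) = mat_zero C vs vs"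
    and zs: "set ?zs \<subseteq> Obj C"
    using X Y by (auto simp: pretr_def)
  obtain r where r: "r \<in> mat_Hom C ?zs ?zs"
    and rA: "mat_restrict A ?zs ?zs r = p" and rB: "mat_restrict ?B ?zs ?zs r = q"
    using mat_restrict_surj[OF zs zs, of p A q ?B] p(1) q(1) unfolding fA fB by blast
  have "r i j = Zero C (?zs ! i) (?zs ! j)" if ij: "i < length ?zs" "j \<le> i" for i j
  proof -
    have j: "j < length ?zs" using ij by simp
    have ob: "?zs ! i \<in> Obj C" "?zs ! j \<in> Obj C"
      using ij(1) j zs by (meson nth_mem subsetD)+
    have same: "r i j = Zero C (?zs ! i) (?zs ! j)"
      if D: "?zs ! i \<in> D" "?zs ! j \<in> D" and ws: "filter (\<lambda>x. x \<in> D) ?zs = ws"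
        and t: "mat_restrict D ?zs ?zs r = t"
          "\<And>i j. \<lbrakk>i < length ws; j \<le> i\<rbrakk> \<Longrightarrow> t i j = Zero C (ws ! i) (ws ! j)" for D t ws
    proof -
      obtain k where k: "k < length (filter (\<lambda>x. x \<in> D) ?zs)" "i = block_idx D ?zs ! k"
        by (rule block_idx_obtain[OF ij(1) D(1)])
      obtain l where l: "l < length (filter (\<lambda>x. x \<in> D) ?zs)" "j = block_idx D ?zs ! l"
        by (rule block_idx_obtain[OF j D(2)])
      have "l \<le> k" using ij(2) k l block_idx_le_iff[OF k(1) l(1)] by simp
      then have "mat_restrict D ?zs ?zs r k l = Zero C (ws ! k) (ws ! l)"
        using t(2)[of k l] k(1) unfolding ws t(1) by simp
      then show ?thesis
        using mat_restrict_entry[OF k(1) l(1), of r] nth_filter_block_idx[OF k(1)]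
          nth_filter_block_idx[OF l(1)] k(2) l(2) ws by simp
    qed
    consider "?zs ! i \<in> A" "?zs ! j \<in> A" | "?zs ! i \<in> ?B" "?zs ! j \<in> ?B"
      | "?zs ! i \<in> A \<longleftrightarrow> ?zs ! j \<notin> A"
      using ob by blast
    then show ?thesis
    proof cases
      case 1
      then show ?thesis by (rule same[OF _ _ fA rA p(2)])
    next
      case 2
      then show ?thesis by (rule same[OF _ _ fB rB q(2)])
    next
      case 3
      then show ?thesis using block_cross[OF A ob _ mat_HomD[OF r ij(1) j]] by blast
    qed
  qed
  \<comment> \<open>By \<open>mat_restrict_inj\<close> the equation may be tested on the two blocks,
    where it is the one satisfied by \<open>p\<close> and by \<open>q\<close>.\<close>
  moreover have "mat_add C ?zs ?zs (mat_diff C ?zs ?zs r) (mat_comp C ?zs ?zs ?zs r r) =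
      mat_zero C ?zs ?zs"
    by (rule mat_restrict_inj[OF A zs zs])
      (use zs r p(3) q(3) in \<open>simp_all only: mat_restrict_add mat_restrict_diff mat_restrict_zero
        mat_closed rA rB fA fB mat_restrict_comp[OF A] mat_restrict_comp[OF block_compl[OF A]]\<close>)
  ultimately have "(?zs, r) \<in> Obj (pretr C)"
    using zs r by (simp add: pretr_def)
  moreover have "fob (restrict_functor A) (?zs, r) = (us, p)"
    "fob (restrict_functor ?B) (?zs, r) = (vs, q)"
    by (simp_all only: restrict_functor_def dgfun.simps prod.case fA fB rA rB)
  ultimately show ?thesis by (rule that)
qed

text \<open>The three conclusions are what \<open>hqe_isomorphic_if_bij\<close> asks of a
  functor.\<close>

lemma (in dg_category_char2) block_split:
  fixes A :: "'o set"
  defines "B \<equiv> full_subcat (pretr C) {(xs, p). set xs \<subseteq> A} \<times>\<^sub>D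
     full_subcat (pretr C) {(xs, p). set xs \<subseteq> Obj C - A}"
    and "F \<equiv> \<lparr>fob = (\<lambda>X. (fob (restrict_functor A) X, fob (restrict_functor (Obj C - A)) X)),
      fmo = (\<lambda>X Y f. (fmo (restrict_functor A) X Y f, fmo (restrict_functor (Obj C - A)) X Y f))\<rparr>"
  assumes A: "block A"
  shows "dg_functor (pretr C) B F"
    and "\<lbrakk>X \<in> Obj (pretr C); Y \<in> Obj (pretr C)\<rbrakk>
      \<Longrightarrow> bij_betw (fmo F X Y) (Hom (pretr C) X Y) (Hom B (fob F X) (fob F Y))"
    and "Obj B \<subseteq> fob F ` Obj (pretr C)"
proof -
  show "dg_functor (pretr C) B F"
    unfolding B_def F_def
    by (intro dg_functor_pair dg_functor_restrict A block_compl)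
  show "bij_betw (fmo F X Y) (Hom (pretr C) X Y) (Hom B (fob F X) (fob F Y))"
    if "X \<in> Obj (pretr C)" "Y \<in> Obj (pretr C)"
  proof -
    obtain xs p ys q where XY: "X = (xs, p)" "Y = (ys, q)" by (cases X, cases Y)
    with that have ob: "set xs \<subseteq> Obj C" "set ys \<subseteq> Obj C" by (auto simp: pretr_def)
    have F: "fmo F X Y = (\<lambda>f. (mat_restrict A xs ys f, mat_restrict (Obj C - A) xs ys f))"
      by (simp add: F_def XY restrict_functor_def)
    have H: "Hom (pretr C) X Y = mat_Hom C xs ys"
      "Hom B (fob F X) (fob F Y) =
        mat_Hom C (filter (\<lambda>x. x \<in> A) xs) (filter (\<lambda>x. x \<in> A) ys) \<times>
        mat_Hom C (filter (\<lambda>x. x \<in> Obj C - A) xs) (filter (\<lambda>x. x \<in> Obj C - A) ys)"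
      by (simp_all add: F_def B_def XY restrict_functor_def dg_product_def full_subcat_def pretr_def)
    show ?thesis
      unfolding F H bij_betw_def
    proof
      show "inj_on (\<lambda>f. (mat_restrict A xs ys f, mat_restrict (Obj C - A) xs ys f)) (mat_Hom C xs ys)"
        by (rule inj_onI, rule mat_restrict_inj[OF A ob]) auto
      show "(\<lambda>f. (mat_restrict A xs ys f, mat_restrict (Obj C - A) xs ys f)) ` mat_Hom C xs ys =
        mat_Hom C (filter (\<lambda>x. x \<in> A) xs) (filter (\<lambda>x. x \<in> A) ys) \<times>
        mat_Hom C (filter (\<lambda>x. x \<in> Obj C - A) xs) (filter (\<lambda>x. x \<in> Obj C - A) ys)" (is "?L = ?R")
      proof
        show "?L \<subseteq> ?R" by (intro image_subsetI SigmaI mat_restrict_closed)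
        show "?R \<subseteq> ?L"
        proof
          fix P assume "P \<in> ?R"
          then obtain f where "f \<in> mat_Hom C xs ys" "mat_restrict A xs ys f = fst P"
            "mat_restrict (Obj C - A) xs ys f = snd P"
            using mat_restrict_surj[OF ob, of "fst P" A "snd P" "Obj C - A"]
            by (metis Diff_disjoint mem_Times_iff)
          then show "P \<in> ?L" by (intro image_eqI[of _ _ f]) simp_all
        qed
      qed
    qed
  qed
  show "Obj B \<subseteq> fob F ` Obj (pretr C)"
  proof
    fix b assume b: "b \<in> Obj B"
    obtain us p vs q where "b = ((us, p), (vs, q))" by (metis prod.exhaust)
    with b have b': "b = ((us, p), (vs, q))" "(us, p) \<in> Obj (pretr C)" "set us \<subseteq> A"
      "(vs, q) \<in> Obj (pretr C)" "set vs \<subseteq> Obj C - A"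
      by (simp_all add: B_def dg_product_def full_subcat_def)
    obtain Z where "Z \<in> Obj (pretr C)" "fob (restrict_functor A) Z = (us, p)"
      "fob (restrict_functor (Obj C - A)) Z = (vs, q)"
      by (rule pretr_amalgamate[OF A b'(2-5)])
    then show "b \<in> fob F ` Obj (pretr C)"
      unfolding b'(1) F_def by (intro image_eqI[of _ _ Z]) simp_all
  qed
qed


section \<open>The sign of the basepoint\<close>

text \<open>
  The morphisms of \<open>L\<close> preserving the side of \<open>P\<close>, and the zero morphisms, form a subcategory
  \<open>T\<close> through which \<open>J\<close> and \<open>K\<close> factor.  By the universal property the identity of \<open>L\<close> factors
  through \<open>T\<close> as well.
\<close>

lemma is_dg_pushout_orthogonal:
  assumes po: "is_dg_pushout B A C F G L J K"
    and A: "\<And>x y f. \<lbrakk>x \<in> Obj A; y \<in> Obj A; fob J x \<in> P \<longleftrightarrow> fob J y \<notin> P; f \<in> Hom A x y\<rbrakk>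
      \<Longrightarrow> fmo J x y f = Zero L (fob J x) (fob J y)"
    and C: "\<And>x y f. \<lbrakk>x \<in> Obj C; y \<in> Obj C; fob K x \<in> P \<longleftrightarrow> fob K y \<notin> P; f \<in> Hom C x y\<rbrakk>
      \<Longrightarrow> fmo K x y f = Zero L (fob K x) (fob K y)"
    and xy: "x \<in> Obj L" "y \<in> Obj L" "x \<in> P \<longleftrightarrow> y \<notin> P"
  shows "Hom L x y = {Zero L x y}"
proof -
  interpret J: dg_functor A L J using po by (simp add: is_dg_pushout_def)
  interpret K: dg_functor C L K using po by (simp add: is_dg_pushout_def)
  \<comment> \<open>Only the morphism sets shrink; types, objects and operations are those of
    \<open>L\<close>, so \<open>T\<close> is an admissible test category.\<close>
  define T where
    "T = L\<lparr>Hom := (\<lambda>x y. if x \<in> P \<longleftrightarrow> y \<in> P then Hom L x y else {Zero L x y})\<rparr>"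
  have T_simps: "Obj T = Obj L" "Zero T = Zero L" "Add T = Add L" "Scale T = Scale L"
    "Diff T = Diff L" "Idn T = Idn L" "Comp T = Comp L"
    "Hom T x y = (if x \<in> P \<longleftrightarrow> y \<in> P then Hom L x y else {Zero L x y})" for x y
    by (simp_all add: T_def)
  have TL: "f \<in> Hom L x y" if "x \<in> Obj L" "y \<in> Obj L" "f \<in> Hom T x y" for x y f
    using that J.B.zero_closed by (auto simp: T_simps split: if_splits)
  interpret T: dg_category T
  proof (unfold_locales, unfold T_simps(1-7), goal_cases)
    case (2 x y f g)
    then show ?case by (auto simp: T_simps J.B.closed J.B.add_zero split: if_splits)
  next
    case (3 x y f c)
    then show ?case by (auto simp: T_simps J.B.closed J.B.scale_zero split: if_splits)
  next
    case (5 x y f g)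
    then show ?case using J.B.add_commute TL by blast
  next
    case (7 x y f)
    then have "Scale L x y (-1) f \<in> Hom T x y"
      by (auto simp: T_simps J.B.closed J.B.scale_zero split: if_splits)
    then show ?case using 7 J.B.add_minus TL by blast
  next
    \<comment> \<open>If \<open>x\<close> and \<open>z\<close> lie on different sides, then
      \<open>y\<close> differs in side from one of them, so one of the two factors is zero.\<close>
    case (13 x y z f g)
    then have "f \<in> Hom L x y" "g \<in> Hom L y z" by (simp_all add: TL)
    moreover have "f = Zero L x y \<or> g = Zero L y z" if "x \<in> P \<longleftrightarrow> z \<notin> P"
      using 13 that by (auto simp: T_simps split: if_splits)
    ultimately show ?case
      using 13 J.B.comp_zero_left[of x y z f] J.B.comp_zero_right[of x y z g]
      by (auto simp: T_simps(8) J.B.closed)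
  next
    case (21 x y f)
    then show ?case by (auto simp: T_simps J.B.closed J.B.diff_zero split: if_splits)
  qed (simp_all add: TL J.B.closed J.B.add_assoc J.B.add_zero J.B.scale_one J.B.scale_scale J.B.scale_add
      J.B.add_scale J.B.comp_idn J.B.idn_comp J.B.comp_assoc J.B.comp_add_left J.B.comp_add_right
      J.B.comp_scale_left J.B.comp_scale_right J.B.diff_add J.B.diff_scale J.B.diff_diff J.B.leibniz
      T_simps(8))
  have JT: "dg_functor A T J"
  proof unfold_locales
    fix x y f assume "x \<in> Obj A" "y \<in> Obj A" "f \<in> Hom A x y"
    then show "fmo J x y f \<in> Hom T (fob J x) (fob J y)"
      using A[of x y f] by (auto simp: T_simps J.fmo_closed)
  qed (simp_all add: T_simps J.fob_closed J.fmo_add J.fmo_scale J.fmo_diff J.fmo_idn J.fmo_comp)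
  have KT: "dg_functor C T K"
  proof unfold_locales
    fix x y f assume "x \<in> Obj C" "y \<in> Obj C" "f \<in> Hom C x y"
    then show "fmo K x y f \<in> Hom T (fob K x) (fob K y)"
      using C[of x y f] by (auto simp: T_simps K.fmo_closed)
  qed (simp_all add: T_simps K.fob_closed K.fmo_add K.fmo_scale K.fmo_diff K.fmo_idn K.fmo_comp)
  obtain U where U: "dg_functor L T U" and UJ: "dgfun_eq_on A (dgfun_comp U J) J"
    and UK: "dgfun_eq_on C (dgfun_comp U K) K"
    using po JT KT unfolding is_dg_pushout_def by blast
  interpret U: dg_functor L T U by fact
  \<comment> \<open>\<open>U\<close> followed by the inclusion of \<open>T\<close> into
    \<open>L\<close>, which changes no values.\<close>
  have UL: "dg_functor L L U"
  proof unfold_locales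
    fix x y f assume "x \<in> Obj L" "y \<in> Obj L" "f \<in> Hom L x y"
    then show "fmo U x y f \<in> Hom L (fob U x) (fob U y)"
      using U.fmo_closed[of x y f] U.fob_closed TL by (simp add: T_simps(1))
  qed (use U.fob_closed in \<open>simp_all add: U.fmo_add U.fmo_scale U.fmo_diff U.fmo_idn U.fmo_comp T_simps(1-7)\<close>)
  have id: "dg_functor L L dgfun_id" "dgfun_eq_on A (dgfun_comp dgfun_id J) J"
    "dgfun_eq_on C (dgfun_comp dgfun_id K) K"
    by (unfold_locales, simp_all add: dgfun_id_def dgfun_comp_def dgfun_eq_on_def)
  \<comment> \<open>\<open>U0\<close> is the endofunctor of \<open>L\<close> induced by
    \<open>J\<close> and \<open>K\<close> themselves; uniqueness identifies both \<open>U\<close>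
    and the identity with it.\<close>
  obtain U0 where U0: "\<forall>U'. dg_functor L L U' \<and> dgfun_eq_on A (dgfun_comp U' J) J \<and>
      dgfun_eq_on C (dgfun_comp U' K) K \<longrightarrow> dgfun_eq_on L U' U0"
    using po J.dg_functor_axioms K.dg_functor_axioms unfolding is_dg_pushout_def by blast
  have "dgfun_eq_on L U U0" "dgfun_eq_on L dgfun_id U0"
    using U0 UL UJ UK id by blast+
  then have Uid: "fob U x = x" "fob U y = y" "f \<in> Hom L x y \<Longrightarrow> fmo U x y f = f" for f
    using xy by (auto simp: dgfun_eq_on_def dgfun_id_def)
  \<comment> \<open>\<open>U\<close> fixes \<open>f\<close> but takes values in \<open>T\<close>,
    where the morphisms from \<open>x\<close> to \<open>y\<close> are zero.\<close>
  have "f = Zero L x y" if "f \<in> Hom L x y" for f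
    using U.fmo_closed[OF xy(1,2) that] Uid that xy(3) by (simp add: T_simps(8))
  then show ?thesis
    using J.B.zero_closed[OF xy(1,2)] by blast
qed

section \<open>Isotopy classes and the region at the basepoint\<close>

lemma divset_class_refl:
  assumes "dividing_set S m D"
  shows "D \<in> divset_class S m D"
proof -
  have "ambient_isotopy S m (\<lambda>t x. x)"
    unfolding ambient_isotopy_def using continuous_map_snd homeomorphic_map_id
    by (auto simp: case_prod_unfold id_def)
  moreover have "carries (\<lambda>x. x) D D" by (simp add: carries_def)
  ultimately show ?thesis
    using assms unfolding divset_class_def by (intro CollectI conjI exI[of _ "\<lambda>t x. x"])
qed

locale marked_surface =
  fixes S :: "'a surface" and m :: "'a set"
  assumes surface: "pointed_surface S" and bdry_nonempty: "bdry S \<noteq> {}" and marking: "marking S m"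
begin

abbreviation "z1 \<equiv> Bases S ! 0"

text \<open>\<open>Bases S ! 0\<close> is meaningful only for a nonempty list. A nonempty boundary
  has a component, and components correspond bijectively to basepoints.\<close>

lemma z1: "z1 \<in> set (Bases S)" "z1 \<in> bdry S" "z1 \<notin> m" "z1 \<in> topspace (Space S)"
proof -
  have top: "bdry S \<subseteq> topspace (Space S)"
  proof
    fix x assume "x \<in> bdry S"
    then obtain U c where "(U, c) \<in> Charts S" "x \<in> U" by (auto simp: bdry_def)
    then have "openin (Space S) U" "x \<in> U"
      using surface by (auto simp: pointed_surface_def is_chart_def)
    then show "x \<in> topspace (Space S)" using openin_subset by blast
  qed
  have "connected_components_of (subtopology (Space S) (bdry S)) \<noteq> {}"
    using bdry_nonempty top Union_connected_components_of[of "subtopology (Space S) (bdry S)"]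
    by (auto simp: topspace_subtopology)
  then have "Bases S \<noteq> []"
    using surface by (auto simp: pointed_surface_def bij_betw_def)
  then show "z1 \<in> set (Bases S)" by simp
  then show "z1 \<in> bdry S" "z1 \<notin> m"
    using surface marking by (auto simp: pointed_surface_def marking_def)
  then show "z1 \<in> topspace (Space S)" using top by blast
qed

lemma z1_region:
  assumes "dividing_set S m D"
  shows "z1 \<in> RNeg D \<longleftrightarrow> z1 \<notin> RPos D"
proof -
  \<comment> \<open>The curve meets the boundary only in \<open>m\<close>, which omits the
    basepoints.\<close>
  have "z1 \<notin> Curve D" "RPos D \<inter> RNeg D = {}" "RPos D \<union> RNeg D = topspace (Space S) - Curve D"
    using assms z1 by (auto simp: dividing_set_def)
  then show ?thesis using z1 by blast
qed

text \<open>An isotopy fixes \<open>z1\<close> and carries positive regions to positive regions.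
  Each dividing set lies in its own class, so equal classes give an isotopy in either direction and
  none has to be inverted.\<close>

lemma divset_class_z1:
  assumes D: "dividing_set S m D" and D': "dividing_set S m D'"
    and eq: "divset_class S m D = divset_class S m D'"
  shows "z1 \<in> RPos D \<longleftrightarrow> z1 \<in> RPos D'"
proof -
  have fwd: "z1 \<in> RPos E'" "dividing_set S m E'"
    if E: "z1 \<in> RPos E" "E' \<in> divset_class S m E" for E E'
  proof -
    obtain H where H: "ambient_isotopy S m H" "carries (H 1) E E'" "dividing_set S m E'"
      using E by (auto simp: divset_class_def)
    then have "H 1 z1 = z1" using z1 by (auto simp: ambient_isotopy_def)
    then show "z1 \<in> RPos E'" "dividing_set S m E'"
      using H E(1) unfolding carries_def by (metis imageI)+
  qed
  show ?thesis
    using fwd[of D D'] fwd[of D' D] divset_class_refl[OF D] divset_class_refl[OF D'] eq by blast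
qed

lemma pos_classes_iff:
  "dividing_set S m D \<Longrightarrow> divset_class S m D \<in> pos_classes S m \<longleftrightarrow> z1 \<in> RPos D"
  unfolding pos_classes_def using divset_class_z1 by blast

text \<open>Identifies the negative piece with the complementary block that
  \<open>block_split\<close> produces.\<close>

lemma neg_classes_eq: "neg_classes S m = Verts (PreKo S m :: (_, _, 'k::field) dgpres) - pos_classes S m"
  by (auto simp: PreKo_def pos_classes_iff z1_region neg_classes_def)

lemma pos_classes_subset: "pos_classes S m \<subseteq> Verts (PreKo S m :: (_, _, 'k::field) dgpres)"
  by (auto simp: PreKo_def pos_classes_def)

section \<open>Bypass moves, triangles and the localized category\<close>

lemma bypass_pos_classes:
  assumes "bypass S m D \<phi> D'"
  shows "divset_class S m D \<in> pos_classes S m \<longleftrightarrow> divset_class S m D' \<in> pos_classes S m"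
proof -
  have D: "dividing_set S m D" "dividing_set S m D'" "\<phi> ` rect \<inter> bdry S = {}"
    and eq: "RPos D' - \<phi> ` rect = RPos D - \<phi> ` rect"
    using assms by (auto simp: bypass_def bypass_via_def bypass_chart_def)
  have "z1 \<notin> \<phi> ` rect" using D(3) z1 by blast
  then show ?thesis using D eq by (auto simp: pos_classes_iff)
qed

lemma is_path_pos_classes:
  "is_path (PreKo S m :: (_, _, 'k::field) dgpres) x p y
    \<Longrightarrow> x \<in> pos_classes S m \<longleftrightarrow> y \<in> pos_classes S m"
proof (induction p arbitrary: x)
  case (Cons e p)
  then have "e \<in> Arrs (PreKo S m :: (_, _, 'k) dgpres)" "gen_src e = x"
    "gen_tgt e \<in> pos_classes S m \<longleftrightarrow> y \<in> pos_classes S m"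
    by (auto simp: PreKo_def)
  then show ?case
    by (auto simp: PreKo_def bypass_gen_def gen_src_def gen_tgt_def dest: bypass_pos_classes)
qed simp

text \<open>No path joins classes of opposite sign, so the only combination of paths is 0.\<close>

lemma PreKo_orthogonal:
  assumes "x \<in> pos_classes S m \<longleftrightarrow> y \<notin> pos_classes S m"
    and "f \<in> Hom (pres_cat (PreKo S m :: (_, _, 'k::field) dgpres)) x y"
  shows "f = Zero (pres_cat (PreKo S m)) x y"
proof -
  have "g = 0" if "g \<in> combs (PreKo S m :: (_, _, 'k) dgpres) x y" for g
    using that assms(1) is_path_pos_classes unfolding combs_def
    by (metis (mono_tags, lifting) equals0I keys_eq_empty mem_Collect_eq)
  then show ?thesis
    using assms(2) by (auto simp: pres_cat_def)
qed

text \<open>The vertices of a triangle are the sources of its three moves, and the first two moves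
  already link them all.\<close>

lemma triangle_pos_classes:
  assumes "(eA, eB, eC) \<in> bypass_triangles S m"
  shows "gen_src eA \<in> pos_classes S m \<longleftrightarrow> gen_src eB \<in> pos_classes S m"
    and "gen_src eB \<in> pos_classes S m \<longleftrightarrow> gen_src eC \<in> pos_classes S m"
proof -
  have via: "divset_class S m D \<in> pos_classes S m \<longleftrightarrow> divset_class S m D' \<in> pos_classes S m"
    if "bypass_via S m D \<phi> A1 A2 A3 D'" for D \<phi> A1 A2 A3 D'
    using that by (intro bypass_pos_classes) (auto simp: bypass_def)
  obtain DA \<phi>A A1 A2 A3 DB \<phi>B B1 B2 B3 DC \<phi>C DA' where
    "eA = bypass_gen S m DA \<phi>A DB" "eB = bypass_gen S m DB \<phi>B DC" "eC = bypass_gen S m DC \<phi>C DA'"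
    "bypass_via S m DA \<phi>A A1 A2 A3 DB" "bypass_via S m DB \<phi>B B1 B2 B3 DC"
    using assms unfolding bypass_triangles_def by blast
  with via show "gen_src eA \<in> pos_classes S m \<longleftrightarrow> gen_src eB \<in> pos_classes S m"
    "gen_src eB \<in> pos_classes S m \<longleftrightarrow> gen_src eC \<in> pos_classes S m"
    by (simp_all add: bypass_gen_def gen_src_def)
qed

lemma L_Xi_orthogonal:
  fixes L :: "('k::field, 'a divset set, 'm) dgcat"
    and E :: "(tri_obj, tri_arr + 'x, 'k) dgpres"
  assumes L: "is_L_Xi S m L E w"
    and xy: "x \<in> Obj L" "y \<in> Obj L" "x \<in> pos_classes S m \<longleftrightarrow> y \<notin> pos_classes S m"
  shows "Hom L x y = {Zero L x y}"
proof -
  let ?I = "bypass_triangles S m"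
  let ?PreKo = "PreKo S m :: (_, _, 'k) dgpres"
  let ?Xi = "Xi S m :: (_, (_ \<Rightarrow>\<^sub>0 'k) set, _, _) dgfun"
  let ?B = "dg_copower ?I (pres_cat (Dprime :: (_, _, 'k) dgpres))" and ?C = "dg_copower ?I (pres_cat E)"
  obtain J K where po: "is_dg_pushout ?B (pres_cat ?PreKo) ?C ?Xi
      (copower_map (pres_functor E id Inl)) L J K"
    and ObL: "Obj L = Verts ?PreKo" and Jid: "\<forall>x\<in>Obj L. fob J x = x"
    using L unfolding is_L_Xi_def by blast
  interpret J: dg_functor "pres_cat ?PreKo" L J using po by (simp add: is_dg_pushout_def)
  interpret K: dg_functor ?C L K using po by (simp add: is_dg_pushout_def)
  interpret Xi: dg_functor ?B "pres_cat ?PreKo" ?Xi using po by (simp add: is_dg_pushout_def)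
  have Jid': "fob J x = x" if "x \<in> Obj (pres_cat ?PreKo)" for x
    using that Jid ObL by (simp add: pres_cat_def)
  \<comment> \<open>\<open>D'\<close> and its resolution have the same objects and \<open>J\<close>
    fixes objects, so the commuting square determines \<open>K\<close> on objects.\<close>
  have fobK: "fob K (i, v) = fob (triangle_functor S m i :: (_, (_ \<Rightarrow>\<^sub>0 'k) set, _, _) dgfun) v"
    if "i \<in> ?I" for i v
  proof -
    have iv: "(i, v) \<in> Obj ?B" using that by (simp add: dg_copower_def pres_cat_def Dprime_def)
    have "dgfun_eq_on ?B (dgfun_comp J ?Xi) (dgfun_comp K (copower_map (pres_functor E id Inl)))"
      using po unfolding is_dg_pushout_def by blast
    then have "fob (dgfun_comp J ?Xi) (i, v) =
        fob (dgfun_comp K (copower_map (pres_functor E id Inl))) (i, v)"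
      unfolding dgfun_eq_on_def using iv by blast
    then have "fob J (fob ?Xi (i, v)) = fob K (i, v)"
      by (simp add: dgfun_comp_def copower_map_def pres_functor_def)
    then show ?thesis
      using Jid'[OF Xi.fob_closed[OF iv]] by (simp add: Xi_def cotuple_def)
  qed
  show ?thesis
  proof (rule is_dg_pushout_orthogonal[OF po _ _ xy])
    fix x y f
    assume *: "x \<in> Obj (pres_cat ?PreKo)" "y \<in> Obj (pres_cat ?PreKo)"
      "fob J x \<in> pos_classes S m \<longleftrightarrow> fob J y \<notin> pos_classes S m" "f \<in> Hom (pres_cat ?PreKo) x y"
    then have "f = Zero (pres_cat ?PreKo) x y"
      by (intro PreKo_orthogonal) (simp_all add: Jid')
    then show "fmo J x y f = Zero L (fob J x) (fob J y)"
      using J.A.dg_functor_zero[OF J.dg_functor_axioms] * by simp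
  next
    fix x y f
    assume *: "x \<in> Obj ?C" "y \<in> Obj ?C"
      "fob K x \<in> pos_classes S m \<longleftrightarrow> fob K y \<notin> pos_classes S m" "f \<in> Hom ?C x y"
    obtain i v j u where iv: "x = (i, v)" "y = (j, u)" by (cases x, cases y)
    then have ij: "i \<in> ?I" "j \<in> ?I" using * by (auto simp: dg_copower_def)
    have side: "fob K (i, v) \<in> pos_classes S m \<longleftrightarrow> fob K (i, u) \<in> pos_classes S m" for v u
    proof -
      obtain eA eB eC where i: "i = (eA, eB, eC)" by (cases i)
      show ?thesis
        unfolding fobK[OF ij(1)]
        using triangle_pos_classes[OF ij(1)[unfolded i]]
        by (simp add: i triangle_functor_def pres_functor_def split: tri_obj.split)
    qed
    \<comment> \<open>One triangle lies on one side, so objects on opposite sides belong to distinct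
      copies, which are orthogonal in the copower.\<close>
    have "i \<noteq> j" using *(3) side unfolding iv by blast
    then have "f = Zero ?C x y" using *(4) by (simp add: iv dg_copower_def)
    then show "fmo K x y f = Zero L (fob K x) (fob K y)"
      using K.A.dg_functor_zero[OF K.dg_functor_axioms] * by simp
  qed
qed

end


theorem proposition4p15:
  fixes S :: "'a surface" and m :: "'a set"
    and E :: "(tri_obj, tri_arr + 'x, 'k::field) dgpres"
    and w :: "(tri_obj, ((tri_arr + 'x) list \<Rightarrow>\<^sub>0 'k) set, tri_obj, (tri_arr list \<Rightarrow>\<^sub>0 'k) set) dgfun"
    and L :: "('k, 'a divset set, 'm) dgcat"
  assumes "CHAR('k) = 2"
    and "pointed_surface S" and "bdry S \<noteq> {}" and "marking S m"
    and "is_L_Xi S m L E w"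
  shows "Ko L \<cong>\<^sub>H Ko_plus S m L \<times>\<^sub>D Ko_minus S m L"
proof -
  interpret marked_surface S m
    using assms by unfold_locales
  have "dg_category L"
    using assms(5) by (auto simp: is_L_Xi_def is_dg_pushout_def dg_functor_def)
  then interpret L: dg_category_char2 L
    using assms(1) by (intro dg_category_char2.intro dg_category_char2_axioms.intro)
  have Obj: "Obj L = Verts (PreKo S m :: (_, _, 'k) dgpres)"
    using assms(5) by (auto simp: is_L_Xi_def)
  have block: "L.block (pos_classes S m)"
    unfolding L.block_def
    using pos_classes_subset[where 'k='k] L_Xi_orthogonal[OF assms(5)] unfolding Obj by blast
  have "Ko_plus S m L = full_subcat (pretr L) {(xs, p). set xs \<subseteq> pos_classes S m}"
    "Ko_minus S m L = full_subcat (pretr L) {(xs, p). set xs \<subseteq> Obj L - pos_classes S m}"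
    unfolding Ko_plus_def Ko_minus_def Ko_def Obj neg_classes_eq[where 'k='k] by simp_all
  then show ?thesis
    using dg_functor.hqe_isomorphic_if_bij[OF L.block_split[OF block]] by (simp add: Ko_def)
qed

end
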